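(* Let $P_l\in\mathbb{R}^{n_l}$ be constant and let $\overline P_m^{opt}$ be the solution of the optimization problem (OPT) in the context. Suppose that: (1) (Solvability) there exist $\overline\eta\in\mathrm{Im}(\mathcal{B}^T)$ and $\overline\omega\in\mathrm{Ker}(\mathcal{B}^T)$ satisfying the steady state equations of the power network with $\overline P_m=\overline P_m^{opt}$; here necessarily $\overline\omega=\boldsymbol 0$, so that $$\boldsymbol 0=-\mathcal{B}_g\Gamma\sin(\overline\eta)+\overline P_m^{opt},\qquad \boldsymbol 0=-\mathcal{B}_l\Gamma\sin(\overline\eta)-P_l ;$$ (2) (Angle differences) $\overline\eta_k\in(-\tfrac{\pi}{2},\tfrac{\pi}{2})$ for all $k\in\mathcal{E}$; (3) (Droop constants) for every $i\in\mathcal{V}_{g2}$ one has $4T_{si}T_{mi}^{-1}>1$, $D_{gi}T_{si}T_{mi}^{-1}>1$ and $$1-\frac{T_{mi}}{T_{si}}-\sqrt{\alpha_i}<K_i^{-1}<1-\frac{T_{mi}}{T_{si}}+\sqrt{\alpha_i},\qquad \alpha_i=T_{mi}^2T_{si}^{-2}(4T_{si}T_{mi}^{-1}-1)(D_{gi}T_{si}T_{mi}^{-1}-1);$$ (4) (Connectivity) the communication graph on $\mathcal{V}_g$ is undirected and connected (it may differ from the topology of the power network). Consider the closed-loop system consisting of the power network, the first-order turbine-governors for $i\in\mathcal{V}_{g1}$, the second-order turbine-governors for $i\in\mathcal{V}_{g2}$, and the distributed controllers, all as given in the context. Then solutions that start sufficiently close to $(\overline\eta,\ \overline\omega=\boldsymbol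 0,\ \overline P_m^{opt},\ \overline P_s^{opt},\ \overline\theta^{opt})$ converge to the set where the frequency is regulated and the power generation solves (OPT), i.e. the set of points at which $\omega=\boldsymbol 0$ and $P_m=\overline P_m^{opt}$.
   Context: Network. The power network is a connected undirected graph with node set $\mathcal{V}_g\cup\mathcal{V}_l$, where $\mathcal{V}_g=\{1,\dots,n_g\}$ are the generator buses, $\mathcal{V}_l=\{n_g+1,\dots,n\}$ are the load buses, $n=n_g+n_l$, and edge set $\mathcal{E}=\{1,\dots,m\}$ (transmission lines). $\mathcal{B}\in\mathbb{R}^{n\times m}$ is its incidence matrix (for an arbitrary orientation, $+1$ at the positive end and $-1$ at the negative end of each edge); $\mathcal{B}_g\in\mathbb{R}^{n_g\times m}$ and $\mathcal{B}_l\in\mathbb{R}^{n_l\times m}$ are its row blocks indexed by $\mathcal{V}_g$ and $\mathcal{V}_l$. $\Gamma=\mathrm{diag}(\gamma_1,\dots,\gamma_m)$ with $\gamma_k=V_iV_jB_{ij}>0$ for line $k=\{i,j\}$ (constant voltages and susceptances). $M$, $D_g$ (generators) and $D_l$ (loads) are diagonal matrices with positive diagonal entries $M_i,D_{gi},D_{li}$. $\sin(\cdot)$ acts componentwise. $\eta=\mathcal{B}^T\delta\in\mathbb{R}^m$, where $\delta\in\mathbb{R}^n$ is the vector of voltage angles, and $\omega=(\omega_g^T,\omega_l^T)^T$ are the frequency deviations. The power network dynamics are $$\dot\eta=\mathcal{B}^T\omega,\qquad M\dot\omega_g=-D_g\omega_g-\mathcal{B}_g\Gamma\sin(\eta)+P_m,\qquad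 \boldsymbol 0=-D_l\omega_l-\mathcal{B}_l\Gamma\sin(\eta)-P_l,$$ where $P_l\in\mathbb{R}^{n_l}$ is constant and $P_m\in\mathbb{R}^{n_g}$ is the generated mechanical power. The steady state equations are obtained by setting the time derivatives to zero: $\boldsymbol 0=\mathcal{B}^T\overline\omega$, $\boldsymbol 0=-D_g\overline\omega_g-\mathcal{B}_g\Gamma\sin(\overline\eta)+\overline P_m$, $\boldsymbol 0=-D_l\overline\omega_l-\mathcal{B}_l\Gamma\sin(\overline\eta)-P_l$. Optimization problem. $C(P_m)=\sum_{i\in\mathcal{V}_g}\left(\tfrac12 q_iP_{mi}^2+r_iP_{mi}+s_i\right)$ with $q_i>0$ and $r_i,s_i\in\mathbb{R}$. (OPT): minimize $C(P_m)$ over $P_m\in\mathbb{R}^{n_g}$ subject to $0=\mathbb{1}_{n_g}^TP_m-\mathbb{1}_{n_l}^TP_l$, where $\mathbb{1}$ is the all-ones vector. Its unique solution is denoted $\overline P_m^{opt}$. Turbine-governors. The generator set is partitioned as $\mathcal{V}_g=\mathcal{V}_{g1}\cup\mathcal{V}_{g2}$. All constants $T_{mi},T_{si},T_{\theta_i},K_i$ are positive. For $i\in\mathcal{V}_{g1}$ (first-order dynamics): $$T_{mi}\dot P_{mi}=-P_{mi}-K_i^{-1}\omega_{gi}+\theta_i .$$ For $i\in\mathcal{V}_{g2}$ (second-order dynamics): $$T_{si}\dot P_{si}=-P_{si}-K_i^{-1}\omega_{gi}+\theta_i,\qquad T_{mi}\dot P_{mi}=-P_{mi}+P_{si}.$$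 Distributed controllers. With $\mathcal{N}_i^{com}$ the neighbours of $i$ in the communication graph on $\mathcal{V}_g$: for $i\in\mathcal{V}_{g1}$, $$T_{\theta_i}\dot\theta_i=-\theta_i+P_{mi}-K_i^{-1}q_i\sum_{j\in\mathcal{N}_i^{com}}\big(q_i\theta_i+r_i-(q_j\theta_j+r_j)\big),$$ and for $i\in\mathcal{V}_{g2}$, $$T_{\theta_i}\dot\theta_i=-\theta_i+P_{si}-(1-K_i^{-1})\omega_{gi}-q_i\sum_{j\in\mathcal{N}_i^{com}}\big(q_i\theta_i+r_i-(q_j\theta_j+r_j)\big).$$ Equilibrium values. $\overline\theta^{opt}=\overline P_m^{opt}$, and $\overline P_{si}^{opt}=\overline P_{mi}^{opt}$ for $i\in\mathcal{V}_{g2}$. *)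

theory Defs
  imports "HOL-Analysis.Analysis"
begin

text \<open>
  Generator buses are the elements of the type \<open>'g\<close>, load buses those of \<open>'l\<close>, all buses those of
  \<open>'g + 'l\<close>, and lines those of \<open>'e\<close>.  Line \<open>k\<close> joins \<open>pos_end N k\<close> and \<open>neg_end N k\<close>, which also
  fixes its (arbitrary) orientation.  The susceptance $B_{ij}$ of line $k = \{i,j\}$ is stored at the
  line \<open>k\<close>.  The fields \<open>inertia\<close>, \<open>gen_damping\<close>, \<open>load_damping\<close> are the diagonals of
  $M$, $D_g$, $D_l$.
\<close>

record ('g, 'l, 'e) power_network =
  pos_end :: "'e \<Rightarrow> 'g + 'l"
  neg_end :: "'e \<Rightarrow> 'g + 'l"
  voltage :: "real ^ ('g::finite + 'l::finite)"
  susceptance :: "real ^ 'e::finite"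
  inertia :: "real ^ 'g"
  gen_damping :: "real ^ 'g"
  load_damping :: "real ^ 'l"
  load_power :: "real ^ 'l"

text \<open>
  \<open>Vg1\<close> and \<open>Vg2\<close> are the generators with first-order and second-order turbine-governors;
  \<open>Tm\<close>, \<open>Ts\<close>, \<open>Ttheta\<close> are the time constants and \<open>droop\<close> is $K$;
  \<open>q_cost\<close>, \<open>r_cost\<close>, \<open>s_cost\<close> are the cost coefficients; \<open>com\<close> is the adjacency relation of
  the communication graph.  Only the entries of \<open>Ts\<close> at \<open>Vg2\<close> matter.
\<close>

record 'g generation =
  Vg1 :: "'g set"
  Vg2 :: "'g set"
  Tm :: "real ^ 'g::finite"
  Ts :: "real ^ 'g"
  Ttheta :: "real ^ 'g"
  droop :: "real ^ 'g"
  q_cost :: "real ^ 'g"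
  r_cost :: "real ^ 'g"
  s_cost :: "real ^ 'g"
  com :: "('g \<times> 'g) set"

definition gen_rows :: "'a ^ ('g::finite + 'l::finite) \<Rightarrow> 'a ^ 'g" where
  "gen_rows v = (\<chi> i. v $ Inl i)"

definition load_rows :: "'a ^ ('g::finite + 'l::finite) \<Rightarrow> 'a ^ 'l" where
  "load_rows v = (\<chi> i. v $ Inr i)"

definition diag_matrix :: "real ^ 'n \<Rightarrow> real ^ 'n ^ 'n" where
  "diag_matrix d = (\<chi> i j. if i = j then d $ i else 0)"

definition sin_vec :: "real ^ 'n \<Rightarrow> real ^ 'n" where
  "sin_vec x = (\<chi> k. sin (x $ k))"

definition incidence ::
    "('g::finite, 'l::finite, 'e::finite) power_network \<Rightarrow> real ^ 'e ^ ('g + 'l)" where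
  "incidence N = (\<chi> i k. if i = pos_end N k then 1 else if i = neg_end N k then -1 else 0)"

definition line_weight ::
    "('g::finite, 'l::finite, 'e::finite) power_network \<Rightarrow> real ^ 'e" where
  "line_weight N =
    (\<chi> k. voltage N $ pos_end N k * voltage N $ neg_end N k * susceptance N $ k)"

definition line_relation ::
    "('g::finite, 'l::finite, 'e::finite) power_network \<Rightarrow> (('g + 'l) \<times> ('g + 'l)) set" where
  "line_relation N = (\<Union>k. {(pos_end N k, neg_end N k), (neg_end N k, pos_end N k)})"

definition connected_relation :: "('v \<times> 'v) set \<Rightarrow> bool" where
  "connected_relation E \<longleftrightarrow> (\<forall>u v. (u, v) \<in> E\<^sup>*)"

definition valid_network :: "('g::finite, 'l::finite, 'e::finite) power_network \<Rightarrow> bool" where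
  "valid_network N \<longleftrightarrow>
     (\<forall>k. pos_end N k \<noteq> neg_end N k) \<and>
     connected_relation (line_relation N) \<and>
     (\<forall>k. line_weight N $ k > 0) \<and>
     (\<forall>i. inertia N $ i > 0) \<and>
     (\<forall>i. gen_damping N $ i > 0) \<and>
     (\<forall>i. load_damping N $ i > 0)"

definition valid_generation :: "'g::finite generation \<Rightarrow> bool" where
  "valid_generation G \<longleftrightarrow>
     Vg1 G \<union> Vg2 G = UNIV \<and> Vg1 G \<inter> Vg2 G = {} \<and>
     (\<forall>i. Tm G $ i > 0) \<and>
     (\<forall>i\<in>Vg2 G. Ts G $ i > 0) \<and>
     (\<forall>i. Ttheta G $ i > 0) \<and>
     (\<forall>i. droop G $ i > 0) \<and>
     (\<forall>i. q_cost G $ i > 0)"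

definition cost :: "'g::finite generation \<Rightarrow> real ^ 'g \<Rightarrow> real" where
  "cost G P = (\<Sum>i\<in>UNIV. q_cost G $ i * (P $ i)\<^sup>2 / 2 + r_cost G $ i * P $ i + s_cost G $ i)"

text \<open>In \<open>real ^ 'n\<close>, \<open>1\<close> is the all-ones vector.\<close>

definition solves_OPT :: "'g::finite generation \<Rightarrow> real ^ 'l::finite \<Rightarrow> real ^ 'g \<Rightarrow> bool" where
  "solves_OPT G Pl P \<longleftrightarrow>
     is_arg_min (cost G) (\<lambda>P. 0 = (1 :: real ^ 'g) \<bullet> P - (1 :: real ^ 'l) \<bullet> Pl) P"

text \<open>In the next three definitions, primed arguments stand for the time derivatives.\<close>

definition network_eqs ::
    "('g::finite, 'l::finite, 'e::finite) power_network \<Rightarrow>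
     real ^ 'e \<Rightarrow> real ^ ('g + 'l) \<Rightarrow> real ^ 'g \<Rightarrow> real ^ 'e \<Rightarrow> real ^ 'g \<Rightarrow> bool" where
  "network_eqs N \<eta> \<omega> Pm \<eta>' \<omega>g' \<longleftrightarrow>
     \<eta>' = transpose (incidence N) *v \<omega> \<and>
     diag_matrix (inertia N) *v \<omega>g' =
       - (diag_matrix (gen_damping N) *v gen_rows \<omega>)
       - (gen_rows (incidence N) ** diag_matrix (line_weight N)) *v sin_vec \<eta> + Pm \<and>
     0 = - (diag_matrix (load_damping N) *v load_rows \<omega>)
       - (load_rows (incidence N) ** diag_matrix (line_weight N)) *v sin_vec \<eta> - load_power N"

definition governor_eqs ::
    "'g::finite generation \<Rightarrow> real ^ 'g \<Rightarrow> real ^ 'g \<Rightarrow> real ^ 'g \<Rightarrow> real ^ 'g \<Rightarrow>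
     real ^ 'g \<Rightarrow> real ^ 'g \<Rightarrow> bool" where
  "governor_eqs G \<omega>g Pm Ps \<theta> Pm' Ps' \<longleftrightarrow>
     (\<forall>i\<in>Vg1 G. Tm G $ i * Pm' $ i = - Pm $ i - inverse (droop G $ i) * \<omega>g $ i + \<theta> $ i) \<and>
     (\<forall>i\<in>Vg2 G.
        Ts G $ i * Ps' $ i = - Ps $ i - inverse (droop G $ i) * \<omega>g $ i + \<theta> $ i \<and>
        Tm G $ i * Pm' $ i = - Pm $ i + Ps $ i)"

definition com_sum :: "'g::finite generation \<Rightarrow> real ^ 'g \<Rightarrow> 'g \<Rightarrow> real" where
  "com_sum G \<theta> i =
     (\<Sum>j\<in>com G `` {i}.
        q_cost G $ i * \<theta> $ i + r_cost G $ i - (q_cost G $ j * \<theta> $ j + r_cost G $ j))"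

definition controller_eqs ::
    "'g::finite generation \<Rightarrow> real ^ 'g \<Rightarrow> real ^ 'g \<Rightarrow> real ^ 'g \<Rightarrow> real ^ 'g \<Rightarrow>
     real ^ 'g \<Rightarrow> bool" where
  "controller_eqs G \<omega>g Pm Ps \<theta> \<theta>' \<longleftrightarrow>
     (\<forall>i\<in>Vg1 G. Ttheta G $ i * \<theta>' $ i =
        - \<theta> $ i + Pm $ i - inverse (droop G $ i) * q_cost G $ i * com_sum G \<theta> i) \<and>
     (\<forall>i\<in>Vg2 G. Ttheta G $ i * \<theta>' $ i =
        - \<theta> $ i + Ps $ i - (1 - inverse (droop G $ i)) * \<omega>g $ i
        - q_cost G $ i * com_sum G \<theta> i)"

text \<open>Setting the time derivatives to zero.\<close>

definition steady_state ::
    "('g::finite, 'l::finite, 'e::finite) power_network \<Rightarrow>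
     real ^ 'e \<Rightarrow> real ^ ('g + 'l) \<Rightarrow> real ^ 'g \<Rightarrow> bool" where
  "steady_state N \<eta> \<omega> Pm \<longleftrightarrow> network_eqs N \<eta> \<omega> Pm 0 0"

text \<open>
  The variable $P_{si}$ exists only for $i$ in \<open>Vg2\<close>.  Vectors indexed by \<open>Vg2\<close> are represented as the
  vectors in \<open>real ^ 'g\<close> that vanish on \<open>Vg1\<close>, so that distances are those of the original state space.
\<close>

definition Ps_opt :: "'g::finite generation \<Rightarrow> real ^ 'g \<Rightarrow> real ^ 'g" where
  "Ps_opt G Pm_opt = (\<chi> i. if i \<in> Vg2 G then Pm_opt $ i else 0)"

text \<open>
  Solutions on $[0,\infty)$ of the closed-loop differential-algebraic system.  The load frequencies
  obey an algebraic equation, so no derivative is demanded of them.  The range condition on \<open>\<eta>\<close>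
  expresses that $\eta = \mathcal{B}^T \delta$ for some vector $\delta$ of voltage angles.
\<close>

definition closed_loop_solution ::
    "('g::finite, 'l::finite, 'e::finite) power_network \<Rightarrow> 'g generation \<Rightarrow>
     (real \<Rightarrow> real ^ 'e) \<Rightarrow> (real \<Rightarrow> real ^ ('g + 'l)) \<Rightarrow> (real \<Rightarrow> real ^ 'g) \<Rightarrow>
     (real \<Rightarrow> real ^ 'g) \<Rightarrow> (real \<Rightarrow> real ^ 'g) \<Rightarrow> bool" where
  "closed_loop_solution N G \<eta> \<omega> Pm Ps \<theta> \<longleftrightarrow>
     (\<exists>\<eta>' \<omega>g' Pm' Ps' \<theta>'. \<forall>t\<ge>0.
        (\<eta> has_vector_derivative \<eta>' t) (at t within {0..}) \<and>
        ((\<lambda>t. gen_rows (\<omega> t)) has_vector_derivative \<omega>g' t) (at t within {0..}) \<and>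
        (Pm has_vector_derivative Pm' t) (at t within {0..}) \<and>
        (Ps has_vector_derivative Ps' t) (at t within {0..}) \<and>
        (\<theta> has_vector_derivative \<theta>' t) (at t within {0..}) \<and>
        \<eta> t \<in> range ((*v) (transpose (incidence N))) \<and>
        (\<forall>i\<in>Vg1 G. Ps t $ i = 0) \<and>
        network_eqs N (\<eta> t) (\<omega> t) (Pm t) (\<eta>' t) (\<omega>g' t) \<and>
        governor_eqs G (gen_rows (\<omega> t)) (Pm t) (Ps t) (\<theta> t) (Pm' t) (Ps' t) \<and>
        controller_eqs G (gen_rows (\<omega> t)) (Pm t) (Ps t) (\<theta> t) (\<theta>' t))"

definition alpha ::
    "('g::finite, 'l::finite, 'e::finite) power_network \<Rightarrow> 'g generation \<Rightarrow> 'g \<Rightarrow> real" where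
  "alpha N G i =
     (Tm G $ i)\<^sup>2 / (Ts G $ i)\<^sup>2 * (4 * Ts G $ i / Tm G $ i - 1)
       * (gen_damping N $ i * Ts G $ i / Tm G $ i - 1)"

definition droop_condition ::
    "('g::finite, 'l::finite, 'e::finite) power_network \<Rightarrow> 'g generation \<Rightarrow> 'g \<Rightarrow> bool" where
  "droop_condition N G i \<longleftrightarrow>
     4 * Ts G $ i / Tm G $ i > 1 \<and>
     gen_damping N $ i * Ts G $ i / Tm G $ i > 1 \<and>
     1 - Tm G $ i / Ts G $ i - sqrt (alpha N G i) < inverse (droop G $ i) \<and>
     inverse (droop G $ i) < 1 - Tm G $ i / Ts G $ i + sqrt (alpha N G i)"

end

theory Submission
  imports Defs
begin

text \<open>
  Lyapunov argument.  At the equilibrium all marginal costs \<open>q\<^sub>i P\<^sub>i + r\<^sub>i\<close> coincide, so the controllers act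
  on the errors through the communication Laplacian.  Add to the kinetic and shifted potential
  energy of the network the storage \<open>K (T\<^sub>m p\<^sup>2 + T\<^sub>\<theta> h\<^sup>2) / 2\<close> of each first-order generator and
  \<open>(T\<^sub>\<theta> h\<^sup>2 + T\<^sub>s s\<^sup>2 + T\<^sub>s (p - s)\<^sup>2) / 2\<close> of each second-order one, where \<open>p\<close>, \<open>s\<close>, \<open>h\<close> are the errors of
  \<open>P\<^sub>m\<close>, \<open>P\<^sub>s\<close>, \<open>\<theta>\<close>.  With the weight \<open>T\<^sub>s\<close> on \<open>(p - s)\<^sup>2\<close>, the dissipation at a second-order generator is
  a quadratic form in \<open>\<omega>\<close>, \<open>p - s\<close>, \<open>s - h\<close> whose determinant is positive exactly under the droop
  condition.  The storage decreases along every solution, and its sublevel sets confine \<open>\<eta>\<close> to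
  the region where the potential energy is positive definite.  Barbalat's lemma, in place of
  LaSalle's principle, makes the dissipated quantities \<open>\<omega>\<close>, \<open>p - h\<close> and the differences of
  \<open>q\<^sub>i h\<^sub>i\<close> vanish; the total momentum then forces the sum of the \<open>p\<^sub>i\<close> to vanish, hence every \<open>p\<^sub>i\<close>.
\<close>

section \<open>Barbalat-type lemmas\<close>

text \<open>Solutions are differentiable only within \<open>{0..}\<close>, hence one-sidedly at time
  0, so the mean value theorem is needed for that filter.\<close>

lemma mvt_halfline:
  fixes f f' :: "real \<Rightarrow> real"
  assumes "\<And>t. 0 \<le> t \<Longrightarrow> (f has_real_derivative f' t) (at t within {0..})"
    and "0 \<le> a" "a < b"
  shows "\<exists>x. a < x \<and> x < b \<and> f b - f a = (b - a) * f' x"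
proof -
  have "(f has_derivative (*) (f' x)) (at x within {a..b})" if "a \<le> x" "x \<le> b" for x
    using has_field_derivative_subset[OF assms(1), of x "{a..b}"] that assms(2)
    by (auto simp: has_field_derivative_def)
  from mvt_simple[OF \<open>a < b\<close> this] show ?thesis
    by (auto simp: mult.commute)
qed

text \<open>If the derivative of \<open>V\<close> is at most \<open>- c h\<^sup>2\<close>, every visit of the Lipschitz function \<open>h\<close> to
  \<open>\<bar>h\<bar> \<ge> e\<close> costs a fixed decrease of \<open>V\<close>.\<close>

lemma barbalat_dissipation:
  fixes V V' h :: "real \<Rightarrow> real"
  assumes V: "\<And>t. 0 \<le> t \<Longrightarrow> (V has_real_derivative V' t) (at t within {0..})"
    and V': "\<And>t. 0 \<le> t \<Longrightarrow> V' t \<le> - (c * (h t)\<^sup>2)"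
    and "0 < c"
    and nonneg: "\<And>t. 0 \<le> t \<Longrightarrow> 0 \<le> V t"
    and lip: "L-lipschitz_on {0..} h"
  shows "(h \<longlongrightarrow> 0) at_top"
proof (rule tendstoI)
  fix e :: real assume "0 < e"
  \<comment> \<open>After a visit to \<open>\<bar>h\<bar> \<ge> e\<close>, the absolute value of
    \<open>h\<close> stays at least \<open>e / 2\<close> for time \<open>d\<close>, which costs
    \<open>V\<close> at least \<open>drop\<close>; the \<open>+ 1\<close> covers
    \<open>L = 0\<close>.\<close>
  define d where "d = e / (2 * (L + 1))"
  define drop where "drop = d * (c * (e / 2)\<^sup>2)"
  have "0 \<le> L" using lip by (rule lipschitz_on_nonneg)
  then have "0 < d" "L * d \<le> e / 2"
    using \<open>0 < e\<close> by (auto simp: d_def divide_simps)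
  then have "0 < drop" using \<open>0 < c\<close> \<open>0 < e\<close> by (simp add: drop_def)
  have anti: "V t \<le> V s" if "0 \<le> s" "s \<le> t" for s t
  proof (cases "s = t")
    case False
    then obtain x where x: "s < x" "V t - V s = (t - s) * V' x"
      using mvt_halfline[OF V, of s t] \<open>0 \<le> s\<close> \<open>s \<le> t\<close> by auto
    have "0 \<le> c * (h x)\<^sup>2" using \<open>0 < c\<close> by simp
    with V'[of x] x \<open>0 \<le> s\<close> have "V' x \<le> 0" by linarith
    with x \<open>s \<le> t\<close> show ?thesis using mult_nonneg_nonpos[of "t - s" "V' x"] by simp
  qed simp
  have bdd: "bdd_below (V ` {0..})" using nonneg by (intro bdd_belowI[of _ 0]) auto
  \<comment> \<open>\<open>V\<close> is nonincreasing and bounded below, so after \<open>T\<close>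
    it can no longer lose \<open>drop\<close>.\<close>
  obtain T where T: "0 \<le> T" "V T < Inf (V ` {0..}) + drop"
    using cInf_lessD[of "V ` {0..}" "Inf (V ` {0..}) + drop"] \<open>0 < drop\<close> by auto
  have "\<bar>h t\<bar> < e" if t: "T \<le> t" for t
  proof (rule ccontr)
    assume "\<not> \<bar>h t\<bar> < e"
    obtain x where x: "t < x" "x < t + d" "V (t + d) - V t = d * V' x"
      using mvt_halfline[OF V, of t "t + d"] T t \<open>0 < d\<close> by auto
    have "\<bar>h t - h x\<bar> \<le> L * \<bar>t - x\<bar>"
      using lipschitz_onD[OF lip, of t x] x T t by (simp add: dist_real_def)
    also have "\<dots> \<le> L * d" using x \<open>0 \<le> L\<close> by (intro mult_left_mono) auto
    finally have "e / 2 \<le> \<bar>h x\<bar>" using \<open>L * d \<le> e / 2\<close> \<open>\<not> \<bar>h t\<bar> < e\<close> by linarith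
    then have "(e / 2)\<^sup>2 \<le> (h x)\<^sup>2" using \<open>0 < e\<close> by (simp add: abs_le_square_iff[symmetric])
    then have "c * (e / 2)\<^sup>2 \<le> c * (h x)\<^sup>2" using \<open>0 < c\<close> by (intro mult_left_mono) auto
    then have "V' x \<le> - (c * (e / 2)\<^sup>2)" using V'[of x] x T t by linarith
    then have "V (t + d) - V t \<le> - drop"
      using \<open>0 < d\<close> mult_left_mono[of "V' x" "- (c * (e / 2)\<^sup>2)" d] x by (simp add: drop_def)
    moreover have "Inf (V ` {0..}) \<le> V (t + d)"
      using bdd T t \<open>0 < d\<close> by (intro cInf_lower) auto
    ultimately show False using anti[of T t] T t by linarith
  qed
  then show "\<forall>\<^sub>F t in at_top. dist (h t) 0 < e"
    by (auto simp: eventually_at_top_linorder dist_real_def)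
qed

text \<open>Over an interval of fixed length \<open>d\<close> the increment of the vanishing
  \<open>f\<close> is small, so \<open>a + b\<close> is small somewhere inside. There
  \<open>b\<close> is small too, and the Lipschitz bound carries the smallness of \<open>a\<close>
  back to the left end. Each of the three errors is allotted \<open>e / 3\<close>.\<close>

lemma barbalat_derivative:
  fixes f a b :: "real \<Rightarrow> real"
  assumes f: "\<And>t. 0 \<le> t \<Longrightarrow> (f has_real_derivative a t + b t) (at t within {0..})"
    and lip: "L-lipschitz_on {0..} a"
    and lim: "(f \<longlongrightarrow> 0) at_top" "(b \<longlongrightarrow> 0) at_top"
  shows "(a \<longlongrightarrow> 0) at_top"
proof (rule tendstoI)
  fix e :: real assume "0 < e"
  define d where "d = e / (3 * (L + 1))"
  have "0 \<le> L" using lip by (rule lipschitz_on_nonneg)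
  then have "0 < d" "L * d \<le> e / 3"
    using \<open>0 < e\<close> by (auto simp: d_def divide_simps)
  have "\<forall>\<^sub>F t in at_top. dist (f t) 0 < d * e / 6" "\<forall>\<^sub>F t in at_top. dist (b t) 0 < e / 3"
    using \<open>0 < d\<close> \<open>0 < e\<close> tendstoD[OF lim(1), of "d * e / 6"] tendstoD[OF lim(2), of "e / 3"] by auto
  then have "\<forall>\<^sub>F t in at_top. 0 \<le> t \<and> dist (f t) 0 < d * e / 6 \<and> dist (b t) 0 < e / 3"
    using eventually_ge_at_top[of "0::real"] by eventually_elim auto
  then obtain T where T: "\<And>t. T \<le> t \<Longrightarrow> 0 \<le> t \<and> \<bar>f t\<bar> < d * e / 6 \<and> \<bar>b t\<bar> < e / 3"
    by (auto simp: eventually_at_top_linorder)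
  have "\<bar>a t\<bar> < e" if t: "T \<le> t" for t
  proof -
    obtain x where x: "t < x" "x < t + d" "f (t + d) - f t = d * (a x + b x)"
      using mvt_halfline[OF f, of t "t + d"] T[OF t] \<open>0 < d\<close> by auto
    have "\<bar>a t - a x\<bar> \<le> L * \<bar>t - x\<bar>"
      using lipschitz_onD[OF lip, of t x] x T[OF t] by (simp add: dist_real_def)
    also have "\<dots> \<le> L * d" using x \<open>0 \<le> L\<close> by (intro mult_left_mono) auto
    finally have "\<bar>a t - a x\<bar> \<le> e / 3" using \<open>L * d \<le> e / 3\<close> by linarith
    moreover have "\<bar>f (t + d) - f t\<bar> < d * e / 3"
      using T[OF t] T[of "t + d"] t \<open>0 < d\<close> by linarith
    then have "d * \<bar>a x + b x\<bar> < d * (e / 3)" using x(3) \<open>0 < d\<close> by (simp add: abs_mult)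
    then have "\<bar>a x + b x\<bar> < e / 3" using \<open>0 < d\<close> by (simp add: abs_mult)
    moreover have "\<bar>b x\<bar> < e / 3" using T[of x] t x by auto
    ultimately show ?thesis by linarith
  qed
  then show "\<forall>\<^sub>F t in at_top. dist (a t) 0 < e"
    by (auto simp: eventually_at_top_linorder dist_real_def)
qed

section \<open>The quadratic form of a second-order generator\<close>

lemma square_form_lower_bound:
  fixes m \<delta> :: real
  assumes "0 < \<delta>"
  obtains c where "0 < c" "\<And>x y. c * (x\<^sup>2 + y\<^sup>2) \<le> (x - m * y)\<^sup>2 + \<delta> * y\<^sup>2"
proof
  \<comment> \<open>The first bound gives \<open>2 * c \<le> 1\<close> and the second
    \<open>c * (2 * m\<^sup>2 + 1) \<le> \<delta>\<close>: these are the coefficients left after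
    estimating \<open>x\<^sup>2\<close> by
    \<open>2 * (x - m * y)\<^sup>2 + 2 * m\<^sup>2 * y\<^sup>2\<close>.\<close>
  define c where "c = min (1 / 2) (\<delta> / (2 * m\<^sup>2 + 1))"
  have pos: "0 < 2 * m\<^sup>2 + 1" using zero_le_power2[of m] by linarith
  show "0 < c" using assms pos by (simp add: c_def)
  have c: "c \<le> 1 / 2" "c \<le> \<delta> / (2 * m\<^sup>2 + 1)"
    unfolding c_def by (rule min.cobounded1, rule min.cobounded2)
  then have c': "c * (2 * m\<^sup>2 + 1) \<le> \<delta>" using pos_le_divide_eq[OF pos] by blast
  show "c * (x\<^sup>2 + y\<^sup>2) \<le> (x - m * y)\<^sup>2 + \<delta> * y\<^sup>2" for x y
  proof -
    have "x\<^sup>2 \<le> 2 * (x - m * y)\<^sup>2 + 2 * m\<^sup>2 * y\<^sup>2"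
      using zero_le_power2[of "x - 2 * m * y"] by (simp add: power2_eq_square algebra_simps)
    then have "c * (x\<^sup>2 + y\<^sup>2) \<le> c * (2 * (x - m * y)\<^sup>2 + 2 * m\<^sup>2 * y\<^sup>2 + y\<^sup>2)"
      using \<open>0 < c\<close> by simp
    also have "\<dots> = (2 * c) * (x - m * y)\<^sup>2 + (c * (2 * m\<^sup>2 + 1)) * y\<^sup>2"
      by (simp add: algebra_simps)
    also have "\<dots> \<le> 1 * (x - m * y)\<^sup>2 + \<delta> * y\<^sup>2"
      using c c' by (intro add_mono mult_right_mono) auto
    finally show ?thesis by simp
  qed
qed

text \<open>The hypotheses on \<open>\<tau>\<close>, \<open>D\<close> and \<open>\<kappa>\<close> say that the leading principal minors of the form, in the
  order \<open>f\<close>, \<open>e\<close>, \<open>w\<close>, are positive.\<close>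

lemma turbine_form_lower_bound:
  fixes \<tau> D \<kappa> :: real
  assumes \<tau>: "4 * \<tau> > 1"
    and \<kappa>: "(\<kappa> - (1 - 1 / \<tau>))\<^sup>2 < (1 / \<tau>)\<^sup>2 * (4 * \<tau> - 1) * (D * \<tau> - 1)"
  obtains c where "0 < c"
    "\<And>w e f. c * (w\<^sup>2 + (e + f)\<^sup>2)
      \<le> D * w\<^sup>2 - (1 + \<kappa>) * w * e - (1 - \<kappa>) * w * f + f\<^sup>2 - e * f + \<tau> * e\<^sup>2"
proof -
  \<comment> \<open>Completing the square in \<open>f\<close> turns the form into
    \<open>g\<^sup>2 + (A * e\<^sup>2 - B * e * w + C * w\<^sup>2)\<close>, with \<open>g\<close> as
    defined below.\<close>
  define A where "A = \<tau> - 1 / 4"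
  define B where "B = (3 + \<kappa>) / 2"
  define C where "C = D - (1 - \<kappa>)\<^sup>2 / 4"
  have "0 < A" "0 < \<tau>" using \<tau> by (auto simp: A_def)
  \<comment> \<open>Multiplied by \<open>\<tau>\<close>, the hypothesis on \<open>\<kappa>\<close>
    becomes the discriminant condition for the remaining form in \<open>e\<close> and
    \<open>w\<close>.\<close>
  have "0 < \<tau> * ((1 / \<tau>)\<^sup>2 * (4 * \<tau> - 1) * (D * \<tau> - 1) - (\<kappa> - (1 - 1 / \<tau>))\<^sup>2)"
    using \<kappa> \<open>0 < \<tau>\<close> by simp
  also have "\<dots> = 4 * A * C - B\<^sup>2"
    using \<open>0 < \<tau>\<close> by (simp add: A_def B_def C_def field_simps power2_eq_square)
  finally have "0 < 4 * A * C - B\<^sup>2" .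
  \<comment> \<open>A second completion of the square, now in \<open>e\<close>: the remaining form
    is \<open>A * ((e - B / (2 * A) * w)\<^sup>2 + \<delta> * w\<^sup>2)\<close>.\<close>
  define \<delta> where "\<delta> = (C - B\<^sup>2 / (4 * A)) / A"
  have "0 < \<delta>" using \<open>0 < 4 * A * C - B\<^sup>2\<close> \<open>0 < A\<close> by (simp add: \<delta>_def field_simps)
  then obtain c1 where c1: "0 < c1"
    "\<And>x y. c1 * (x\<^sup>2 + y\<^sup>2) \<le> (x - B / (2 * A) * y)\<^sup>2 + \<delta> * y\<^sup>2"
    using square_form_lower_bound[of \<delta> "B / (2 * A)"] by metis
  \<comment> \<open>Writing \<open>e + f = g + l\<close> with \<open>l\<close> linear in
    \<open>e\<close> and \<open>w\<close>, the left-hand side is at most a combination of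
    \<open>g\<^sup>2\<close>, \<open>e\<^sup>2\<close>, \<open>w\<^sup>2\<close> with coefficients
    \<open>2 * c\<close>, \<open>9 * c\<close>, \<open>c * (1 + (1 - \<kappa>)\<^sup>2)\<close>.
    These must not exceed 1, \<open>A * c1\<close>, \<open>A * c1\<close>.\<close>
  define c where "c = min (1 / 2) (A * c1 / (9 + (1 - \<kappa>)\<^sup>2))"
  have pos: "0 < 9 + (1 - \<kappa>)\<^sup>2" using zero_le_power2[of "1 - \<kappa>"] by linarith
  have "0 < c" using pos \<open>0 < A\<close> c1(1) by (simp add: c_def)
  moreover have "c \<le> 1 / 2" "c \<le> A * c1 / (9 + (1 - \<kappa>)\<^sup>2)"
    unfolding c_def by (rule min.cobounded1, rule min.cobounded2)
  ultimately have c: "0 < c" "c \<le> 1 / 2" "c * (9 + (1 - \<kappa>)\<^sup>2) \<le> A * c1"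
    using pos_le_divide_eq[OF pos] by blast+
  show thesis
  proof (rule that[OF c(1)])
    fix w e f :: real
    define g where "g = f - (e + (1 - \<kappa>) * w) / 2"
    define l where "l = 3 / 2 * e + (1 - \<kappa>) / 2 * w"
    have l: "l\<^sup>2 \<le> 9 / 2 * e\<^sup>2 + (1 - \<kappa>)\<^sup>2 / 2 * w\<^sup>2"
      using zero_le_power2[of "3 / 2 * e - (1 - \<kappa>) / 2 * w"]
      by (simp add: l_def power2_eq_square field_simps)
    have "e + f = g + l" by (simp add: g_def l_def field_simps)
    then have "(e + f)\<^sup>2 \<le> 2 * g\<^sup>2 + 2 * l\<^sup>2"
      using zero_le_power2[of "g - l"] by (simp add: power2_eq_square algebra_simps)
    also have "\<dots> \<le> 2 * g\<^sup>2 + 9 * e\<^sup>2 + (1 - \<kappa>)\<^sup>2 * w\<^sup>2" using l by simp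
    finally have *: "c * (w\<^sup>2 + (e + f)\<^sup>2) \<le> c * (w\<^sup>2 + (2 * g\<^sup>2 + 9 * e\<^sup>2 + (1 - \<kappa>)\<^sup>2 * w\<^sup>2))"
      using c by simp
    show "c * (w\<^sup>2 + (e + f)\<^sup>2)
      \<le> D * w\<^sup>2 - (1 + \<kappa>) * w * e - (1 - \<kappa>) * w * f + f\<^sup>2 - e * f + \<tau> * e\<^sup>2"
    proof -
      have "c * (w\<^sup>2 + (e + f)\<^sup>2)
          \<le> (2 * c) * g\<^sup>2 + (c * 9) * e\<^sup>2 + (c * (1 + (1 - \<kappa>)\<^sup>2)) * w\<^sup>2"
        using * by (simp add: algebra_simps)
      also have "\<dots> \<le> 1 * g\<^sup>2 + (A * c1) * e\<^sup>2 + (A * c1) * w\<^sup>2"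
      proof (intro add_mono mult_right_mono)
        have "c * 9 + c * (1 - \<kappa>)\<^sup>2 \<le> A * c1" using c by (simp add: distrib_left)
        moreover have "0 \<le> c * (1 - \<kappa>)\<^sup>2" using c by simp
        ultimately show "c * 9 \<le> A * c1" "c * (1 + (1 - \<kappa>)\<^sup>2) \<le> A * c1"
          using c unfolding distrib_left by linarith+
      qed (use c in auto)
      also have "\<dots> \<le> g\<^sup>2 + A * ((e - B / (2 * A) * w)\<^sup>2 + \<delta> * w\<^sup>2)"
        using mult_left_mono[OF c1(2)[of e w], of A] \<open>0 < A\<close> by (simp add: algebra_simps)
      also have "\<dots> = g\<^sup>2 + (A * e\<^sup>2 - B * e * w + C * w\<^sup>2)"
        using \<open>0 < A\<close> by (simp add: \<delta>_def power2_eq_square field_simps)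
      also have "\<dots> = D * w\<^sup>2 - (1 + \<kappa>) * w * e - (1 - \<kappa>) * w * f + f\<^sup>2 - e * f + \<tau> * e\<^sup>2"
        by (simp add: g_def A_def B_def C_def power2_eq_square field_simps)
      finally show ?thesis .
    qed
  qed
qed

section \<open>Network and communication graph\<close>

text \<open>The net power that leaves bus \<open>i\<close> along its lines, that is, component
  \<open>i\<close> of the incidence matrix times \<open>\<Gamma>\<close> times the vector of
  sines.\<close>

definition flow ::
    "('g::finite, 'l::finite, 'e::finite) power_network \<Rightarrow> real ^ 'e \<Rightarrow> 'g + 'l \<Rightarrow> real" where
  "flow N \<eta> i = (\<Sum>k\<in>UNIV. incidence N $ i $ k * (line_weight N $ k * sin (\<eta> $ k)))"

lemma diag_matrix_mult_component [simp]: "(diag_matrix d *v x) $ i = d $ i * x $ i"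
  by (simp add: diag_matrix_def matrix_vector_mult_def if_distrib[of "\<lambda>a. a * _"] cong: if_cong)

lemma matrix_mult_diag_matrix_component:
  "(A ** diag_matrix d) $ i $ k = A $ i $ k * d $ k"
  by (simp add: diag_matrix_def matrix_matrix_mult_def if_distrib[of "\<lambda>a. _ * a"] cong: if_cong)

lemma gen_rows_flow [simp]:
  "((gen_rows (incidence N) ** diag_matrix (line_weight N)) *v sin_vec \<eta>) $ i = flow N \<eta> (Inl i)"
  by (simp add: matrix_vector_mult_def matrix_mult_diag_matrix_component flow_def gen_rows_def
      sin_vec_def mult.assoc)

lemma load_rows_flow [simp]:
  "((load_rows (incidence N) ** diag_matrix (line_weight N)) *v sin_vec \<eta>) $ i = flow N \<eta> (Inr i)"
  by (simp add: matrix_vector_mult_def matrix_mult_diag_matrix_component flow_def load_rows_def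
      sin_vec_def mult.assoc)

lemma incidence_transpose_component:
  assumes "valid_network N"
  shows "(transpose (incidence N) *v w) $ k = w $ pos_end N k - w $ neg_end N k"
proof -
  have "incidence N $ i $ k * w $ i =
      (if i = pos_end N k then w $ i else 0) - (if i = neg_end N k then w $ i else 0)" for i
    using assms by (auto simp: incidence_def valid_network_def)
  then show ?thesis
    by (simp add: matrix_vector_mult_def transpose_def sum_subtractf)
qed

text \<open>Adjointness of the incidence matrix and its transpose. With frequencies for
  \<open>w\<close> it converts line power into bus power; with \<open>w = 1\<close> the right-hand
  side vanishes, since each line delivers at one end what it takes at the other.\<close>

lemma sum_flow:
  assumes "valid_network N"
  shows "(\<Sum>i\<in>UNIV. w $ i * flow N \<eta> i) =
    (\<Sum>k\<in>UNIV. line_weight N $ k * sin (\<eta> $ k) * (w $ pos_end N k - w $ neg_end N k))"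
proof -
  have "(\<Sum>i\<in>UNIV. w $ i * flow N \<eta> i) =
      (\<Sum>i\<in>UNIV. \<Sum>k\<in>UNIV. line_weight N $ k * sin (\<eta> $ k) * (incidence N $ i $ k * w $ i))"
    by (simp add: flow_def sum_distrib_left mult_ac)
  also have "\<dots> = (\<Sum>k\<in>UNIV. line_weight N $ k * sin (\<eta> $ k) * (transpose (incidence N) *v w) $ k)"
    by (subst sum.swap) (simp add: matrix_vector_mult_def transpose_def sum_distrib_left)
  finally show ?thesis using incidence_transpose_component[OF assms] by simp
qed

lemma sum_UNIV_sum_type:
  fixes f :: "'a::finite + 'b::finite \<Rightarrow> 'c::comm_monoid_add"
  shows "(\<Sum>i\<in>UNIV. f i) = (\<Sum>i\<in>UNIV. f (Inl i)) + (\<Sum>i\<in>UNIV. f (Inr i))"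
  by (simp add: UNIV_Plus_UNIV[symmetric] sum.Plus comp_def del: UNIV_Plus_UNIV)

lemma sum_flow_eq_0:
  assumes "valid_network N"
  shows "(\<Sum>i\<in>UNIV. flow N \<eta> (Inl i)) + (\<Sum>i\<in>UNIV. flow N \<eta> (Inr i)) = 0"
  using sum_flow[OF assms, of 1 \<eta>] by (simp add: sum_UNIV_sum_type)

lemma network_eqs_components:
  assumes "valid_network N"
  shows "network_eqs N \<eta> \<omega> P \<eta>' \<omega>g' \<longleftrightarrow>
    (\<forall>k. \<eta>' $ k = \<omega> $ pos_end N k - \<omega> $ neg_end N k) \<and>
    (\<forall>i. inertia N $ i * \<omega>g' $ i =
       - (gen_damping N $ i * \<omega> $ Inl i) - flow N \<eta> (Inl i) + P $ i) \<and>
    (\<forall>i. 0 = - (load_damping N $ i * \<omega> $ Inr i) - flow N \<eta> (Inr i) - load_power N $ i)"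
  by (simp add: network_eqs_def vec_eq_iff incidence_transpose_component[OF assms]
      del: transpose_matrix_vector) (simp add: gen_rows_def load_rows_def)

lemma connected_relation_constant:
  assumes "connected_relation E" "\<And>u v. (u, v) \<in> E \<Longrightarrow> f u = f v"
  shows "f u = f v"
proof -
  have "(u, v) \<in> E\<^sup>*" using assms(1) by (simp add: connected_relation_def)
  then show ?thesis by induction (auto dest: assms(2))
qed

lemma incidence_transpose_kernel:
  assumes "valid_network N" "transpose (incidence N) *v w = 0"
  shows "w $ i = w $ j"
proof (rule connected_relation_constant[where f = "\<lambda>u. w $ u"])
  show "connected_relation (line_relation N)" using assms(1) by (simp add: valid_network_def)
  have "w $ pos_end N k = w $ neg_end N k" for k
    using incidence_transpose_component[OF assms(1), of w k] assms(2) by simp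
  then show "w $ u = w $ v" if "(u, v) \<in> line_relation N" for u v
    using that by (auto simp: line_relation_def)
qed

text \<open>By symmetry, swapping the ends of each pair leaves the sum of
  \<open>z i * (z i - z j)\<close> unchanged, and the two versions add up to the sum of squares. The
  factor 1/2 appears because \<open>E\<close> lists each undirected edge in both directions.\<close>

lemma laplacian_form:
  fixes z :: "'v::finite \<Rightarrow> real"
  assumes "sym E"
  shows "(\<Sum>i\<in>UNIV. z i * (\<Sum>j\<in>E `` {i}. z i - z j)) = (\<Sum>(i, j)\<in>E. (z i - z j)\<^sup>2) / 2"
proof -
  have E: "E = (SIGMA i:UNIV. E `` {i})" by auto
  have "(\<Sum>i\<in>UNIV. z i * (\<Sum>j\<in>E `` {i}. z i - z j)) = (\<Sum>(i, j)\<in>E. z i * (z i - z j))"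
    by (subst (2) E, subst sum.Sigma[symmetric]) (auto simp: sum_distrib_left)
  moreover have "(\<Sum>(i, j)\<in>E. z i * (z i - z j)) = (\<Sum>(i, j)\<in>E. z j * (z j - z i))"
    by (rule sum.reindex_bij_witness[where i = prod.swap and j = prod.swap])
      (use assms in \<open>auto dest: symD\<close>)
  moreover have "(\<Sum>(i, j)\<in>E. (z i - z j)\<^sup>2)
      = (\<Sum>(i, j)\<in>E. z i * (z i - z j)) + (\<Sum>(i, j)\<in>E. z j * (z j - z i))"
    unfolding sum.distrib[symmetric]
    by (rule sum.cong) (auto simp: power2_eq_square algebra_simps)
  ultimately show ?thesis by simp
qed

section \<open>The optimization problem\<close>

lemma quadratic_nonneg_linear_coeff_0:
  fixes a b :: real
  assumes "0 < b" "\<And>t. 0 \<le> t * a + t\<^sup>2 * b"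
  shows "a = 0"
proof -
  \<comment> \<open>The vertex of the parabola, where its value is lowest.\<close>
  have "0 \<le> (- a / (2 * b)) * a + (- a / (2 * b))\<^sup>2 * b" by (rule assms(2))
  also have "\<dots> = - (a\<^sup>2 / (4 * b))"
    using assms(1) by (simp add: field_simps power2_eq_square)
  finally have "a\<^sup>2 \<le> 0" using assms(1) by (simp add: field_simps)
  then show ?thesis by simp
qed

lemma solves_OPT_balance:
  "solves_OPT G Pl P \<Longrightarrow> (\<Sum>i\<in>UNIV. P $ i) = (\<Sum>i\<in>UNIV. Pl $ i)"
  by (auto simp: solves_OPT_def is_arg_min_def inner_vec_def)

text \<open>First-order optimality by variation: moving an amount \<open>t\<close> of production
  from \<open>j\<close> to \<open>i\<close> keeps the balance and changes the cost by a quadratic in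
  \<open>t\<close> whose linear coefficient is the difference of marginal costs. Optimality forces
  that coefficient to vanish.\<close>

lemma solves_OPT_marginal_cost:
  assumes G: "valid_generation G" and opt: "solves_OPT G Pl P"
  shows "q_cost G $ i * P $ i + r_cost G $ i = q_cost G $ j * P $ j + r_cost G $ j"
proof (cases "i = j")
  case False
  define m where "m k = q_cost G $ k * P $ k + r_cost G $ k" for k
  have "m i - m j = 0"
  proof (rule quadratic_nonneg_linear_coeff_0)
    show "0 < (q_cost G $ i + q_cost G $ j) / 2"
      using G by (simp add: valid_generation_def add_pos_pos)
    fix t :: real
    define Q where "Q = (\<chi> k. P $ k + ((if k = i then t else 0) + (if k = j then - t else 0)))"
    have "(\<Sum>k\<in>UNIV. Q $ k) = (\<Sum>k\<in>UNIV. P $ k)"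
      by (simp add: Q_def sum.distrib)
    then have "\<not> cost G Q < cost G P"
      using opt by (auto simp: solves_OPT_def is_arg_min_def inner_vec_def)
    moreover have "cost G Q - cost G P =
        (\<Sum>k\<in>UNIV. (if k = i then t * m k + t\<^sup>2 * q_cost G $ k / 2 else 0)
                + (if k = j then - (t * m k) + t\<^sup>2 * q_cost G $ k / 2 else 0))"
      unfolding cost_def sum_subtractf[symmetric]
      using False by (intro sum.cong) (auto simp: Q_def m_def power2_eq_square field_simps)
    then have "cost G Q - cost G P = t * (m i - m j) + t\<^sup>2 * ((q_cost G $ i + q_cost G $ j) / 2)"
      by (simp add: sum.distrib algebra_simps add_divide_distrib)
    ultimately show "0 \<le> t * (m i - m j) + t\<^sup>2 * ((q_cost G $ i + q_cost G $ j) / 2)" by simp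
  qed
  then show ?thesis by (simp add: m_def)
qed simp

section \<open>Storage functions\<close>

text \<open>The Bregman distance of the potential \<open>- cos\<close> from \<open>a\<close> to
  \<open>x\<close>: the linear term moves the critical point of the potential to
  \<open>a\<close>.\<close>

definition line_storage :: "real \<Rightarrow> real \<Rightarrow> real" where
  "line_storage a x = cos a - cos x - sin a * (x - a)"

lemma line_storage_self [simp]: "line_storage a a = 0"
  by (simp add: line_storage_def)

lemma has_real_derivative_line_storage:
  assumes "(f has_real_derivative f') (at t within S)"
  shows "((\<lambda>t. line_storage a (f t)) has_real_derivative (sin (f t) - sin a) * f') (at t within S)"
  unfolding line_storage_def
  by (auto intro!: derivative_eq_intros assms simp: algebra_simps)

text \<open>The derivative \<open>sin z - sin a\<close> has the sign of \<open>z - a\<close>,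
  because the sine is strictly increasing on this interval. This is where the bound on the
  equilibrium angle differences enters.\<close>

lemma line_storage_pos:
  assumes "a \<in> {- pi / 2 <..< pi / 2}" "x \<in> {- pi / 2 <..< pi / 2}" "x \<noteq> a"
  shows "0 < line_storage a x"
proof -
  have deriv: "DERIV (line_storage a) z :> sin z - sin a" for z
    using has_real_derivative_line_storage[OF DERIV_ident, of a z UNIV] by simp
  show ?thesis
  proof (cases "a < x")
    case True
    then obtain z where z: "a < z" "z < x"
        "line_storage a x - line_storage a a = (x - a) * (sin z - sin a)"
      using MVT2[OF True deriv] by blast
    moreover have "sin a < sin z" using assms z by (intro sin_monotone_2pi) auto
    ultimately show ?thesis using True by simp
  next
    case False
    then have "x < a" using assms by simp
    then obtain z where z: "x < z" "z < a"
        "line_storage a a - line_storage a x = (a - x) * (sin z - sin a)"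
      using MVT2[OF \<open>x < a\<close> deriv] by blast
    moreover have "sin z < sin a" using assms z by (intro sin_monotone_2pi) auto
    then have "(a - x) * (sin z - sin a) < 0" using \<open>x < a\<close> by (simp add: mult_less_0_iff)
    ultimately show ?thesis by simp
  qed
qed

lemma line_storage_nonneg:
  "a \<in> {- pi / 2 <..< pi / 2} \<Longrightarrow> x \<in> {- pi / 2 <..< pi / 2} \<Longrightarrow> 0 \<le> line_storage a x"
  using line_storage_pos[of a x] by (cases "x = a") auto

text \<open>A first-order generator has no state \<open>s\<close>, and its storage ignores that
  argument. Hence the storage vanishes at the equilibrium although \<open>Ps_opt\<close> is 0 on
  \<open>Vg1\<close>, where the error of \<open>Ps\<close> need not be 0.\<close>

definition gen_storage :: "'g::finite generation \<Rightarrow> 'g \<Rightarrow> real \<Rightarrow> real \<Rightarrow> real \<Rightarrow> real" where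
  "gen_storage G i p s h =
     (if i \<in> Vg1 G then droop G $ i / 2 * (Tm G $ i * p\<^sup>2 + Ttheta G $ i * h\<^sup>2)
      else (Ttheta G $ i * h\<^sup>2 + Ts G $ i * s\<^sup>2 + Ts G $ i * (p - s)\<^sup>2) / 2)"

definition gen_storage_rate ::
    "'g::finite generation \<Rightarrow> 'g \<Rightarrow> real \<Rightarrow> real \<Rightarrow> real \<Rightarrow> real \<Rightarrow> real \<Rightarrow> real \<Rightarrow> real" where
  "gen_storage_rate G i p s h p' s' h' =
     (if i \<in> Vg1 G then droop G $ i * (Tm G $ i * p * p' + Ttheta G $ i * h * h')
      else Ttheta G $ i * h * h' + Ts G $ i * s * s' + Ts G $ i * (p - s) * (p' - s'))"

lemma has_real_derivative_gen_storage:
  assumes "(p has_real_derivative p') (at t within S)" "(s has_real_derivative s') (at t within S)"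
    "(h has_real_derivative h') (at t within S)"
  shows "((\<lambda>t. gen_storage G i (p t) (s t) (h t)) has_real_derivative
    gen_storage_rate G i (p t) (s t) (h t) p' s' h') (at t within S)"
  unfolding gen_storage_def gen_storage_rate_def
  by (cases "i \<in> Vg1 G")
    (auto intro!: derivative_eq_intros assms simp: field_simps)

lemma gen_storage_nonneg:
  assumes "valid_generation G"
  shows "0 \<le> gen_storage G i p s h"
proof -
  have "i \<in> Vg1 G \<or> i \<in> Vg2 G" using assms by (auto simp: valid_generation_def)
  then show ?thesis
    using assms by (auto simp: gen_storage_def valid_generation_def less_imp_le)
qed

text \<open>One generator's share of the derivative of the total storage: damping, the power
  \<open>w * p\<close> from the swing equation, and the rate of its own storage. In the first-order
  case the weight \<open>K\<close> undoes the factors \<open>1 / K\<close>, so \<open>w * p\<close>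
  cancels and squares remain. In the second-order case the remainder is the form of
  \<open>turbine_form_lower_bound\<close> in \<open>w\<close>, \<open>p - s\<close>,
  \<open>s - h\<close>. The term with the communication input \<open>u\<close> is kept, since it
  acquires a sign only after summation over the graph. As \<open>c\<close> precedes the states, it
  is uniform in time.\<close>

lemma gen_dissipation:
  assumes N: "valid_network N" and G: "valid_generation G"
    and droop: "i \<in> Vg2 G \<Longrightarrow> droop_condition N G i"
  obtains c where "0 < c"
    "\<And>w p s h p' s' h' u.
      (i \<in> Vg1 G \<Longrightarrow> Tm G $ i * p' = - p - inverse (droop G $ i) * w + h \<and>
        Ttheta G $ i * h' = - h + p - inverse (droop G $ i) * q_cost G $ i * u) \<Longrightarrow>
      (i \<in> Vg2 G \<Longrightarrow> Ts G $ i * s' = - s - inverse (droop G $ i) * w + h \<and>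
        Tm G $ i * p' = - p + s \<and>
        Ttheta G $ i * h' = - h + s - (1 - inverse (droop G $ i)) * w - q_cost G $ i * u) \<Longrightarrow>
      - gen_damping N $ i * w\<^sup>2 + w * p + gen_storage_rate G i p s h p' s' h'
        \<le> - (q_cost G $ i * h * u) - c * (w\<^sup>2 + (p - h)\<^sup>2)"
proof (cases "i \<in> Vg1 G")
  case True
  define K D where "K = droop G $ i" and "D = gen_damping N $ i"
  have pos: "0 < K" "0 < D" using N G by (auto simp: K_def D_def valid_network_def valid_generation_def)
  show thesis
  proof (rule that[of "min K D"])
    fix w p s h p' s' h' u :: real
    assume "i \<in> Vg1 G \<Longrightarrow> Tm G $ i * p' = - p - inverse (droop G $ i) * w + h \<and>
        Ttheta G $ i * h' = - h + p - inverse (droop G $ i) * q_cost G $ i * u"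
    with True have eqs: "Tm G $ i * p' = - p - inverse K * w + h"
        "Ttheta G $ i * h' = - h + p - inverse K * q_cost G $ i * u" by (auto simp: K_def)
    have "gen_storage_rate G i p s h p' s' h' = K * (p * (Tm G $ i * p') + h * (Ttheta G $ i * h'))"
      using True by (simp add: gen_storage_rate_def K_def algebra_simps)
    also have "\<dots> = - K * (p - h)\<^sup>2 - w * p - q_cost G $ i * h * u"
      unfolding eqs using pos by (simp add: field_simps power2_eq_square)
    finally have "- D * w\<^sup>2 + w * p + gen_storage_rate G i p s h p' s' h'
        = - (q_cost G $ i * h * u) - (D * w\<^sup>2 + K * (p - h)\<^sup>2)" by simp
    moreover have "min K D * w\<^sup>2 \<le> D * w\<^sup>2" "min K D * (p - h)\<^sup>2 \<le> K * (p - h)\<^sup>2"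
      by (auto intro: mult_right_mono)
    ultimately show "- gen_damping N $ i * w\<^sup>2 + w * p + gen_storage_rate G i p s h p' s' h'
        \<le> - (q_cost G $ i * h * u) - min K D * (w\<^sup>2 + (p - h)\<^sup>2)"
      by (simp add: D_def distrib_left)
  qed (use pos in auto)
next
  case False
  then have i: "i \<in> Vg2 G" using G by (auto simp: valid_generation_def)
  define \<kappa> D T where "\<kappa> = inverse (droop G $ i)" and "D = gen_damping N $ i"
    and "T = Ts G $ i / Tm G $ i"
  have pos: "0 < Tm G $ i" "0 < Ts G $ i" "0 < D"
    using N G i by (auto simp: D_def valid_network_def valid_generation_def)
  have T: "1 < 4 * T" "1 < D * T"
    using droop[OF i] by (auto simp: droop_condition_def T_def D_def)
  have \<alpha>: "alpha N G i = (1 / T)\<^sup>2 * (4 * T - 1) * (D * T - 1)"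
    by (simp add: alpha_def T_def D_def power_divide)
  have "\<bar>\<kappa> - (1 - 1 / T)\<bar> < sqrt (alpha N G i)"
    using droop[OF i] by (auto simp: droop_condition_def T_def \<kappa>_def)
  then have "(\<kappa> - (1 - 1 / T))\<^sup>2 < alpha N G i"
    using real_less_rsqrt by (metis abs_le_square_iff linorder_not_le real_sqrt_abs real_sqrt_less_iff)
  then obtain c where c: "0 < c" "\<And>w e f. c * (w\<^sup>2 + (e + f)\<^sup>2)
      \<le> D * w\<^sup>2 - (1 + \<kappa>) * w * e - (1 - \<kappa>) * w * f + f\<^sup>2 - e * f + T * e\<^sup>2"
    using turbine_form_lower_bound[OF T(1)] unfolding \<alpha> by metis
  show thesis
  proof (rule that[OF c(1)])
    fix w p s h p' s' h' u :: real
    assume "i \<in> Vg2 G \<Longrightarrow> Ts G $ i * s' = - s - inverse (droop G $ i) * w + h \<and>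
        Tm G $ i * p' = - p + s \<and>
        Ttheta G $ i * h' = - h + s - (1 - inverse (droop G $ i)) * w - q_cost G $ i * u"
    with i have eqs: "Ts G $ i * s' = - s - \<kappa> * w + h" "Tm G $ i * p' = - p + s"
        "Ttheta G $ i * h' = - h + s - (1 - \<kappa>) * w - q_cost G $ i * u" by (auto simp: \<kappa>_def)
    have "s - p = Tm G $ i * p'" using eqs(2) by simp
    \<comment> \<open>The turbine equation gives \<open>Tm * p'\<close>, whereas the storage weights
      \<open>p - s\<close> by \<open>Ts\<close>; the ratio \<open>T\<close> of the two becomes the
      coefficient \<open>\<tau>\<close> of the form.\<close>
    then have p': "Ts G $ i * p' = T * (s - p)" using pos by (simp add: T_def)
    have "gen_storage_rate G i p s h p' s' h' = h * (Ttheta G $ i * h') + s * (Ts G $ i * s')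
        + (p - s) * (Ts G $ i * p' - Ts G $ i * s')"
      using False by (simp add: gen_storage_rate_def algebra_simps)
    then have "- D * w\<^sup>2 + w * p + gen_storage_rate G i p s h p' s' h' = - (q_cost G $ i * h * u)
        - (D * w\<^sup>2 - (1 + \<kappa>) * w * (p - s) - (1 - \<kappa>) * w * (s - h) + (s - h)\<^sup>2
           - (p - s) * (s - h) + T * (p - s)\<^sup>2)"
      unfolding eqs p' by (simp add: power2_eq_square algebra_simps)
    then show "- gen_damping N $ i * w\<^sup>2 + w * p + gen_storage_rate G i p s h p' s' h'
        \<le> - (q_cost G $ i * h * u) - c * (w\<^sup>2 + (p - h)\<^sup>2)"
      using c(2)[of w "p - s" "s - h"] by (simp add: D_def)
  qed
qed

section \<open>Bounded functions on the half-line\<close>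

text \<open>Only nonnegative times count, as the equations hold only there. The closure rules
  collected below let bounds on rates be read off the right-hand sides of the equations.\<close>

definition bounded_halfline :: "(real \<Rightarrow> real) \<Rightarrow> bool" where
  "bounded_halfline f \<longleftrightarrow> (\<exists>B. \<forall>t\<ge>0. \<bar>f t\<bar> \<le> B)"

lemma bounded_halflineI: "(\<And>t. 0 \<le> t \<Longrightarrow> \<bar>f t\<bar> \<le> B) \<Longrightarrow> bounded_halfline f"
  by (auto simp: bounded_halfline_def)

lemma bounded_halfline_const: "bounded_halfline (\<lambda>t. c)"
  by (rule bounded_halflineI[of _ "\<bar>c\<bar>"]) simp

lemma bounded_halfline_add:
  assumes "bounded_halfline f" "bounded_halfline g"
  shows "bounded_halfline (\<lambda>t. f t + g t)"
proof -
  from assms obtain A B where "\<forall>t\<ge>0. \<bar>f t\<bar> \<le> A" "\<forall>t\<ge>0. \<bar>g t\<bar> \<le> B"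
    by (auto simp: bounded_halfline_def)
  then show ?thesis
    by (intro bounded_halflineI[of _ "A + B"]) (meson abs_triangle_ineq add_mono order_trans)
qed

lemma bounded_halfline_mult:
  assumes "bounded_halfline f" "bounded_halfline g"
  shows "bounded_halfline (\<lambda>t. f t * g t)"
proof -
  from assms obtain A B where "\<forall>t\<ge>0. \<bar>f t\<bar> \<le> A" "\<forall>t\<ge>0. \<bar>g t\<bar> \<le> B"
    by (auto simp: bounded_halfline_def)
  then show ?thesis
    by (intro bounded_halflineI[of _ "A * B"]) (auto simp: abs_mult intro!: mult_mono)
qed

lemma bounded_halfline_uminus: "bounded_halfline f \<Longrightarrow> bounded_halfline (\<lambda>t. - f t)"
  by (simp add: bounded_halfline_def)

lemma bounded_halfline_diff:
  "bounded_halfline f \<Longrightarrow> bounded_halfline g \<Longrightarrow> bounded_halfline (\<lambda>t. f t - g t)"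
  using bounded_halfline_add[of f "\<lambda>t. - g t"] bounded_halfline_uminus[of g] by simp

lemma bounded_halfline_divide: "bounded_halfline f \<Longrightarrow> bounded_halfline (\<lambda>t. f t / c)"
  using bounded_halfline_mult[of f "\<lambda>t. inverse c"] bounded_halfline_const
  by (simp add: divide_inverse)

lemma bounded_halfline_sum:
  assumes "\<And>i. i \<in> A \<Longrightarrow> bounded_halfline (f i)"
  shows "bounded_halfline (\<lambda>t. \<Sum>i\<in>A. f i t)"
  using assms
  by (induction A rule: infinite_finite_induct) (auto intro: bounded_halfline_add bounded_halfline_const)

lemma bounded_halfline_sin: "bounded_halfline (\<lambda>t. sin (f t))"
  by (rule bounded_halflineI[of _ 1]) simp

lemma bounded_halfline_cos: "bounded_halfline (\<lambda>t. cos (f t))"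
  by (rule bounded_halflineI[of _ 1]) simp

lemmas bounded_halfline_intros = bounded_halfline_const bounded_halfline_add bounded_halfline_mult
  bounded_halfline_uminus bounded_halfline_diff bounded_halfline_divide bounded_halfline_sum
  bounded_halfline_sin bounded_halfline_cos

lemma bounded_halfline_cong:
  "bounded_halfline g \<Longrightarrow> (\<And>t. 0 \<le> t \<Longrightarrow> f t = g t) \<Longrightarrow> bounded_halfline f"
  by (auto simp: bounded_halfline_def)

lemma bounded_halfline_square:
  assumes "0 < a" "\<And>t. 0 \<le> t \<Longrightarrow> a * (f t)\<^sup>2 \<le> C"
  shows "bounded_halfline f"
proof (rule bounded_halflineI)
  fix t :: real assume "0 \<le> t"
  then have "(f t)\<^sup>2 \<le> C / a" using assms by (simp add: field_simps)
  then show "\<bar>f t\<bar> \<le> sqrt (C / a)" by (simp add: real_le_rsqrt)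
qed

lemma bounded_derivative_lipschitz:
  assumes f: "\<And>t. 0 \<le> t \<Longrightarrow> (f has_real_derivative f' t) (at t within {0..})"
    and "bounded_halfline f'"
  obtains L where "L-lipschitz_on {0..} f"
proof -
  obtain B where B: "\<And>t. 0 \<le> t \<Longrightarrow> \<bar>f' t\<bar> \<le> B"
    using assms(2) by (auto simp: bounded_halfline_def)
  have le: "\<bar>f b - f a\<bar> \<le> B * (b - a)" if "0 \<le> a" "a < b" for a b
  proof -
    obtain x where "a < x" "f b - f a = (b - a) * f' x"
      using mvt_halfline[OF f \<open>0 \<le> a\<close> \<open>a < b\<close>] by blast
    then show ?thesis using B[of x] \<open>0 \<le> a\<close> \<open>a < b\<close> by (simp add: abs_mult mult.commute)
  qed
  have "B-lipschitz_on {0..} f"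
  proof (rule lipschitz_onI)
    show "0 \<le> B" using B[of 0] by simp
    fix x y :: real assume "x \<in> {0..}" "y \<in> {0..}"
    then show "dist (f x) (f y) \<le> B * dist x y"
      using le[of x y] le[of y x] by (cases x y rule: linorder_cases) (auto simp: dist_real_def)
  qed
  then show thesis by (rule that)
qed

lemma has_vector_derivative_component:
  assumes "(f has_vector_derivative f') F"
  shows "((\<lambda>t. f t $ i) has_real_derivative f' $ i) F"
  using bounded_linear.has_vector_derivative[OF bounded_linear_vec_nth assms]
  by (simp add: has_real_derivative_iff_has_vector_derivative)

lemma continuous_on_gen_storage:
  assumes "continuous_on S p" "continuous_on S s" "continuous_on S h"
  shows "continuous_on S (\<lambda>x. gen_storage G i (p x) (s x) (h x))"
  unfolding gen_storage_def by (cases "i \<in> Vg1 G") (auto intro!: continuous_intros assms)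

section \<open>The closed loop\<close>

text \<open>The steady state enters in coordinates and with frequency already zero; the final proof
  derives this before interpreting the locale.\<close>

locale optimal_equilibrium =
  fixes N :: "('g::finite, 'l::finite, 'e::finite) power_network"
    and G :: "'g generation" and \<eta>_bar :: "real ^ 'e" and Pm_opt :: "real ^ 'g"
  assumes network: "valid_network N" and generation: "valid_generation G"
    and opt: "solves_OPT G (load_power N) Pm_opt"
    and gen_balance: "\<And>i. flow N \<eta>_bar (Inl i) = Pm_opt $ i"
    and load_balance: "\<And>i. flow N \<eta>_bar (Inr i) = - load_power N $ i"
    and angles: "\<And>k. \<eta>_bar $ k \<in> {- pi / 2 <..< pi / 2}"
    and droop: "\<And>i. i \<in> Vg2 G \<Longrightarrow> droop_condition N G i"
    and com_sym: "sym (com G)" and com_connected: "connected_relation (com G)"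
begin

definition storage where
  "storage \<eta> \<omega> Pm Ps \<theta> =
     (\<Sum>k\<in>UNIV. line_weight N $ k * line_storage (\<eta>_bar $ k) (\<eta> $ k)) +
     (\<Sum>i\<in>UNIV. inertia N $ i / 2 * (\<omega> $ (Inl i :: 'g + 'l))\<^sup>2) +
     (\<Sum>i\<in>UNIV. gen_storage G i (Pm $ i - Pm_opt $ i) (Ps $ i - Pm_opt $ i) (\<theta> $ i - Pm_opt $ i))"

lemma network_pos:
  "0 < line_weight N $ k" "0 < inertia N $ i" "0 < gen_damping N $ i" "0 < load_damping N $ j"
  using network by (auto simp: valid_network_def)

lemma storage_equilibrium: "storage \<eta>_bar 0 Pm_opt (Ps_opt G Pm_opt) Pm_opt = 0"
proof -
  have "i \<in> Vg1 G \<or> i \<in> Vg2 G" for i using generation by (auto simp: valid_generation_def)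
  then have "gen_storage G i 0 (Ps_opt G Pm_opt $ i - Pm_opt $ i) 0 = 0" for i
    by (auto simp: gen_storage_def Ps_opt_def)
  then show ?thesis by (simp add: storage_def)
qed

text \<open>Supplies the initial conditions of \<open>confinement\<close>: the storage is continuous
  and vanishes at the equilibrium, and the distance in the product space dominates each angle
  error.\<close>

lemma storage_near_equilibrium:
  assumes "0 < u" "0 < r"
  obtains \<epsilon> where "0 < \<epsilon>"
    "\<And>\<eta> \<omega> Pm Ps \<theta>. dist (\<eta>, \<omega>, Pm, Ps, \<theta>) (\<eta>_bar, 0, Pm_opt, Ps_opt G Pm_opt, Pm_opt) < \<epsilon> \<Longrightarrow>
      storage \<eta> \<omega> Pm Ps \<theta> < u \<and> (\<forall>k. \<bar>\<eta> $ k - \<eta>_bar $ k\<bar> < r)"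
proof -
  define F where "F x = storage (fst x) (fst (snd x)) (fst (snd (snd x)))
    (fst (snd (snd (snd x)))) (snd (snd (snd (snd x))))" for x
  have "continuous_on UNIV F"
    unfolding F_def storage_def line_storage_def
    by (intro continuous_intros continuous_on_gen_storage)
  then obtain \<delta> where \<delta>: "0 < \<delta>" "\<And>x. dist x (\<eta>_bar, 0, Pm_opt, Ps_opt G Pm_opt, Pm_opt) < \<delta> \<Longrightarrow>
      dist (F x) (F (\<eta>_bar, 0, Pm_opt, Ps_opt G Pm_opt, Pm_opt)) < u"
    unfolding continuous_on_iff using \<open>0 < u\<close> by (metis UNIV_I)
  show thesis
  proof (rule that[of "min \<delta> r"])
    fix \<eta> :: "real ^ 'e" and \<omega> :: "real ^ ('g + 'l)" and Pm Ps \<theta> :: "real ^ 'g"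
    assume d: "dist (\<eta>, \<omega>, Pm, Ps, \<theta>) (\<eta>_bar, 0, Pm_opt, Ps_opt G Pm_opt, Pm_opt) < min \<delta> r"
    then have "storage \<eta> \<omega> Pm Ps \<theta> < u"
      using \<delta>(2)[of "(\<eta>, \<omega>, Pm, Ps, \<theta>)"] by (simp add: F_def storage_equilibrium dist_real_def)
    moreover have "\<bar>\<eta> $ k - \<eta>_bar $ k\<bar> < r" for k
    proof -
      have "\<bar>\<eta> $ k - \<eta>_bar $ k\<bar> \<le> dist \<eta> \<eta>_bar"
        using component_le_norm_cart[of "\<eta> - \<eta>_bar" k] by (simp add: dist_norm)
      also have "\<dots> < r"
        using dist_fst_le[of "(\<eta>, \<omega>, Pm, Ps, \<theta>)" "(\<eta>_bar, 0, Pm_opt, Ps_opt G Pm_opt, Pm_opt)"] d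
        by simp
      finally show ?thesis .
    qed
    ultimately show "storage \<eta> \<omega> Pm Ps \<theta> < u \<and> (\<forall>k. \<bar>\<eta> $ k - \<eta>_bar $ k\<bar> < r)" by blast
  qed (use \<delta> \<open>0 < r\<close> in auto)
qed

text \<open>The radius \<open>r\<close> is half the smallest margin between an equilibrium angle
  difference and \<open>pi / 2\<close>. At distance exactly \<open>r\<close> the storage of every
  line is positive, and \<open>u\<close> is the minimum over the finitely many lines and both
  signs.\<close>

lemma storage_barrier:
  obtains r u where "0 < r" "0 < u" "\<And>k x. \<bar>x - \<eta>_bar $ k\<bar> \<le> r \<Longrightarrow> x \<in> {- pi / 2 <..< pi / 2}"
    "\<And>k x. \<bar>x - \<eta>_bar $ k\<bar> = r \<Longrightarrow> u \<le> line_weight N $ k * line_storage (\<eta>_bar $ k) x"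
proof -
  define m where "m = Max (range (\<lambda>k. \<bar>\<eta>_bar $ k\<bar>))"
  define r where "r = (pi / 2 - m) / 2"
  have "\<bar>\<eta>_bar $ k\<bar> < pi / 2" for k using angles[of k] by auto
  then have "m < pi / 2" unfolding m_def by (subst Max_less_iff) auto
  then have "0 < r" by (simp add: r_def)
  have m: "\<bar>\<eta>_bar $ k\<bar> \<le> m" for k by (simp add: m_def)
  have inside: "x \<in> {- pi / 2 <..< pi / 2}" if "\<bar>x - \<eta>_bar $ k\<bar> \<le> r" for k x
  proof -
    have "\<bar>x - \<eta>_bar $ k\<bar> \<le> (pi / 2 - m) / 2" using that by (simp add: r_def)
    then have "x - \<eta>_bar $ k \<le> (pi / 2 - m) / 2" "\<eta>_bar $ k - x \<le> (pi / 2 - m) / 2" by linarith+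
    moreover have "\<eta>_bar $ k \<le> m" "- \<eta>_bar $ k \<le> m" using m[of k] by linarith+
    ultimately have "- (pi / 2) < x" "x < pi / 2" using \<open>m < pi / 2\<close> by (simp_all add: field_simps)
    then show ?thesis by simp
  qed
  define f where "f = (\<lambda>(k, x). line_weight N $ k * line_storage (\<eta>_bar $ k) (\<eta>_bar $ k + x))"
  define u where "u = Min (f ` (UNIV \<times> {r, - r}))"
  have "0 < f (k, x)" if "x \<in> {r, - r}" for k x
    using that inside[of "\<eta>_bar $ k + x" k] \<open>0 < r\<close> angles[of k]
    by (auto simp: f_def intro!: mult_pos_pos network_pos line_storage_pos)
  then have "0 < u" by (auto simp: u_def)
  moreover have "u \<le> line_weight N $ k * line_storage (\<eta>_bar $ k) x" if "\<bar>x - \<eta>_bar $ k\<bar> = r" for k x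
  proof -
    have "x - \<eta>_bar $ k \<in> {r, - r}" using that by auto
    then have "u \<le> f (k, x - \<eta>_bar $ k)" unfolding u_def by (intro Min_le) auto
    then show ?thesis by (simp add: f_def)
  qed
  ultimately show thesis using that \<open>0 < r\<close> inside by blast
qed

end

section \<open>Decrease of the storage along a solution\<close>

locale closed_loop = optimal_equilibrium N G \<eta>_bar Pm_opt
  for N :: "('g::finite, 'l::finite, 'e::finite) power_network"
    and G :: "'g generation" and \<eta>_bar :: "real ^ 'e" and Pm_opt :: "real ^ 'g" +
  fixes \<eta> \<eta>' :: "real \<Rightarrow> real ^ 'e" and \<omega> :: "real \<Rightarrow> real ^ ('g + 'l)"
    and \<omega>g' Pm Ps \<theta> Pm' Ps' \<theta>' :: "real \<Rightarrow> real ^ 'g"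
  assumes derivs: "\<And>t. 0 \<le> t \<Longrightarrow> (\<eta> has_vector_derivative \<eta>' t) (at t within {0..})"
      "\<And>t. 0 \<le> t \<Longrightarrow> ((\<lambda>t. gen_rows (\<omega> t)) has_vector_derivative \<omega>g' t) (at t within {0..})"
      "\<And>t. 0 \<le> t \<Longrightarrow> (Pm has_vector_derivative Pm' t) (at t within {0..})"
      "\<And>t. 0 \<le> t \<Longrightarrow> (Ps has_vector_derivative Ps' t) (at t within {0..})"
      "\<And>t. 0 \<le> t \<Longrightarrow> (\<theta> has_vector_derivative \<theta>' t) (at t within {0..})"
    and network_eqs: "\<And>t. 0 \<le> t \<Longrightarrow> network_eqs N (\<eta> t) (\<omega> t) (Pm t) (\<eta>' t) (\<omega>g' t)"
    and governor_eqs: "\<And>t. 0 \<le> t \<Longrightarrow>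
      governor_eqs G (gen_rows (\<omega> t)) (Pm t) (Ps t) (\<theta> t) (Pm' t) (Ps' t)"
    and controller_eqs: "\<And>t. 0 \<le> t \<Longrightarrow>
      controller_eqs G (gen_rows (\<omega> t)) (Pm t) (Ps t) (\<theta> t) (\<theta>' t)"
begin

definition Pm_err where "Pm_err i t = Pm t $ i - Pm_opt $ i"
definition Ps_err where "Ps_err i t = Ps t $ i - Pm_opt $ i"
definition \<theta>_err where "\<theta>_err i t = \<theta> t $ i - Pm_opt $ i"
definition marginal_err where "marginal_err i t = q_cost G $ i * \<theta>_err i t"
definition com_err where "com_err i t = (\<Sum>j\<in>com G `` {i}. marginal_err i t - marginal_err j t)"
definition W where "W t = storage (\<eta> t) (\<omega> t) (Pm t) (Ps t) (\<theta> t)"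

lemma line_deriv: "0 \<le> t \<Longrightarrow> ((\<lambda>t. \<eta> t $ k) has_real_derivative
    \<omega> t $ pos_end N k - \<omega> t $ neg_end N k) (at t within {0..})"
  using has_vector_derivative_component[OF derivs(1), of t k] network_eqs[of t]
  by (simp add: network_eqs_components[OF network])

lemma swing:
  assumes "0 \<le> t"
  shows "((\<lambda>t. \<omega> t $ Inl i) has_real_derivative \<omega>g' t $ i) (at t within {0..})"
    "inertia N $ i * \<omega>g' t $ i =
      - (gen_damping N $ i * \<omega> t $ Inl i) - flow N (\<eta> t) (Inl i) + Pm t $ i"
    "load_damping N $ j * \<omega> t $ Inr j = - flow N (\<eta> t) (Inr j) - load_power N $ j"
proof -
  show "((\<lambda>t. \<omega> t $ Inl i) has_real_derivative \<omega>g' t $ i) (at t within {0..})"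
    using has_vector_derivative_component[OF derivs(2)[OF assms], of i] by (simp add: gen_rows_def)
  show "inertia N $ i * \<omega>g' t $ i =
      - (gen_damping N $ i * \<omega> t $ Inl i) - flow N (\<eta> t) (Inl i) + Pm t $ i"
    using network_eqs[OF assms] by (simp add: network_eqs_components[OF network])
  have "0 = - (load_damping N $ j * \<omega> t $ Inr j) - flow N (\<eta> t) (Inr j) - load_power N $ j"
    using network_eqs[OF assms] unfolding network_eqs_components[OF network] by blast
  then show "load_damping N $ j * \<omega> t $ Inr j = - flow N (\<eta> t) (Inr j) - load_power N $ j"
    by simp
qed

lemma power_derivs:
  assumes "0 \<le> t"
  shows "(Pm_err i has_real_derivative Pm' t $ i) (at t within {0..})"
    "(Ps_err i has_real_derivative Ps' t $ i) (at t within {0..})"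
    "(\<theta>_err i has_real_derivative \<theta>' t $ i) (at t within {0..})"
  unfolding Pm_err_def[abs_def] Ps_err_def[abs_def] \<theta>_err_def[abs_def]
  by (auto intro!: derivative_eq_intros has_vector_derivative_component derivs assms)

text \<open>Equal marginal costs at the optimum cancel in each difference, which removes
  \<open>r_cost\<close> and leaves a linear Laplacian term in the errors.\<close>

lemma com_sum_eq: "com_sum G (\<theta> t) i = com_err i t"
  unfolding com_sum_def com_err_def marginal_err_def \<theta>_err_def
proof (rule sum.cong[OF refl])
  fix j
  show "q_cost G $ i * \<theta> t $ i + r_cost G $ i - (q_cost G $ j * \<theta> t $ j + r_cost G $ j) =
      q_cost G $ i * (\<theta> t $ i - Pm_opt $ i) - q_cost G $ j * (\<theta> t $ j - Pm_opt $ j)"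
    using solves_OPT_marginal_cost[OF generation opt, of i j] by (simp add: algebra_simps)
qed

lemma governor1:
  assumes "0 \<le> t" "i \<in> Vg1 G"
  shows "Tm G $ i * Pm' t $ i = - Pm_err i t - inverse (droop G $ i) * \<omega> t $ Inl i + \<theta>_err i t"
    "Ttheta G $ i * \<theta>' t $ i = - \<theta>_err i t + Pm_err i t - inverse (droop G $ i) * q_cost G $ i * com_err i t"
  using governor_eqs[OF assms(1)] controller_eqs[OF assms(1)] assms(2)
  by (auto simp: governor_eqs_def controller_eqs_def com_sum_eq Pm_err_def \<theta>_err_def gen_rows_def)

lemma governor2:
  assumes "0 \<le> t" "i \<in> Vg2 G"
  shows "Ts G $ i * Ps' t $ i = - Ps_err i t - inverse (droop G $ i) * \<omega> t $ Inl i + \<theta>_err i t"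
    "Tm G $ i * Pm' t $ i = - Pm_err i t + Ps_err i t"
    "Ttheta G $ i * \<theta>' t $ i =
      - \<theta>_err i t + Ps_err i t - (1 - inverse (droop G $ i)) * \<omega> t $ Inl i - q_cost G $ i * com_err i t"
  using governor_eqs[OF assms(1)] controller_eqs[OF assms(1)] assms(2)
  by (auto simp: governor_eqs_def controller_eqs_def com_sum_eq Pm_err_def Ps_err_def \<theta>_err_def gen_rows_def)

definition W' where
  "W' t = (\<Sum>k\<in>UNIV. line_weight N $ k * ((sin (\<eta> t $ k) - sin (\<eta>_bar $ k)) *
              (\<omega> t $ pos_end N k - \<omega> t $ neg_end N k))) +
     (\<Sum>i\<in>UNIV. inertia N $ i * \<omega>g' t $ i * \<omega> t $ Inl i) +
     (\<Sum>i\<in>UNIV. gen_storage_rate G i (Pm_err i t) (Ps_err i t) (\<theta>_err i t) (Pm' t $ i) (Ps' t $ i) (\<theta>' t $ i))"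

lemma W_deriv:
  assumes "0 \<le> t"
  shows "(W has_real_derivative W' t) (at t within {0..})"
proof -
  have W: "W = (\<lambda>t. (\<Sum>k\<in>UNIV. line_weight N $ k * line_storage (\<eta>_bar $ k) (\<eta> t $ k)) +
     (\<Sum>i\<in>UNIV. inertia N $ i / 2 * (\<omega> t $ Inl i)\<^sup>2) +
     (\<Sum>i\<in>UNIV. gen_storage G i (Pm_err i t) (Ps_err i t) (\<theta>_err i t)))"
    by (simp add: fun_eq_iff W_def storage_def Pm_err_def Ps_err_def \<theta>_err_def)
  have "((\<lambda>t. inertia N $ i / 2 * (\<omega> t $ Inl i)\<^sup>2) has_real_derivative
      inertia N $ i * \<omega>g' t $ i * \<omega> t $ Inl i) (at t within {0..})" for i
    by (auto intro!: derivative_eq_intros swing[OF assms])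
  then show ?thesis
    unfolding W W'_def
    by (intro DERIV_add DERIV_sum DERIV_cmult has_real_derivative_line_storage line_deriv
        has_real_derivative_gen_storage power_derivs assms)
qed

text \<open>Line power is moved to the buses. At loads the algebraic equation turns it into damping,
  at generators the swing equation and \<open>gen_dissipation\<close> apply, and the communication
  terms add up to a Laplacian form.\<close>

lemma dissipation:
  obtains c where "\<And>i. 0 < c i"
    "\<And>t. 0 \<le> t \<Longrightarrow> W' t \<le> - ((\<Sum>j\<in>UNIV. load_damping N $ j * (\<omega> t $ Inr j)\<^sup>2) +
        (\<Sum>i\<in>UNIV. c i * ((\<omega> t $ Inl i)\<^sup>2 + (Pm_err i t - \<theta>_err i t)\<^sup>2)) +
        (\<Sum>(i, j)\<in>com G. (marginal_err i t - marginal_err j t)\<^sup>2) / 2)"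
proof -
  have "\<exists>c>0. \<forall>t\<ge>0. - gen_damping N $ i * (\<omega> t $ Inl i)\<^sup>2 + \<omega> t $ Inl i * Pm_err i t
      + gen_storage_rate G i (Pm_err i t) (Ps_err i t) (\<theta>_err i t) (Pm' t $ i) (Ps' t $ i) (\<theta>' t $ i)
      \<le> - (marginal_err i t * com_err i t) - c * ((\<omega> t $ Inl i)\<^sup>2 + (Pm_err i t - \<theta>_err i t)\<^sup>2)" for i
    using gen_dissipation[OF network generation droop, of i] unfolding marginal_err_def
    by (smt (verit, ccfv_threshold) governor1 governor2)
  then obtain c where c: "\<And>i. 0 < c i"
    "\<And>i t. 0 \<le> t \<Longrightarrow> - gen_damping N $ i * (\<omega> t $ Inl i)\<^sup>2 + \<omega> t $ Inl i * Pm_err i t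
      + gen_storage_rate G i (Pm_err i t) (Ps_err i t) (\<theta>_err i t) (Pm' t $ i) (Ps' t $ i) (\<theta>' t $ i)
      \<le> - (marginal_err i t * com_err i t) - c i * ((\<omega> t $ Inl i)\<^sup>2 + (Pm_err i t - \<theta>_err i t)\<^sup>2)"
    by metis
  show thesis
  proof (rule that[OF c(1)])
    fix t :: real assume t: "0 \<le> t"
    \<comment> \<open>\<open>sum_flow\<close> is used twice, at the current and at the equilibrium
      angles; the equilibrium flows are then replaced by the optimal generation and the
      load.\<close>
    have "(\<Sum>k\<in>UNIV. line_weight N $ k * ((sin (\<eta> t $ k) - sin (\<eta>_bar $ k)) *
              (\<omega> t $ pos_end N k - \<omega> t $ neg_end N k)))
        = (\<Sum>i\<in>UNIV. \<omega> t $ i * flow N (\<eta> t) i) - (\<Sum>i\<in>UNIV. \<omega> t $ i * flow N \<eta>_bar i)"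
      unfolding sum_flow[OF network] sum_subtractf[symmetric] by (simp add: algebra_simps)
    also have "\<dots> = (\<Sum>i\<in>UNIV. \<omega> t $ Inl i * (flow N (\<eta> t) (Inl i) - Pm_opt $ i))
        + (\<Sum>j\<in>UNIV. \<omega> t $ Inr j * (flow N (\<eta> t) (Inr j) + load_power N $ j))"
      by (simp add: sum_UNIV_sum_type gen_balance load_balance algebra_simps sum.distrib sum_subtractf
          sum_negf)
    also have "(\<Sum>j\<in>UNIV. \<omega> t $ Inr j * (flow N (\<eta> t) (Inr j) + load_power N $ j))
        = - (\<Sum>j\<in>UNIV. load_damping N $ j * (\<omega> t $ Inr j)\<^sup>2)"
      unfolding sum_negf[symmetric]
    proof (rule sum.cong[OF refl])
      fix j
      have "flow N (\<eta> t) (Inr j) + load_power N $ j = - (load_damping N $ j * \<omega> t $ Inr j)"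
        using swing(3)[OF t, of j] by simp
      then show "\<omega> t $ Inr j * (flow N (\<eta> t) (Inr j) + load_power N $ j)
          = - (load_damping N $ j * (\<omega> t $ Inr j)\<^sup>2)" by (simp add: power2_eq_square)
    qed
    finally have lines: "(\<Sum>k\<in>UNIV. line_weight N $ k * ((sin (\<eta> t $ k) - sin (\<eta>_bar $ k)) *
              (\<omega> t $ pos_end N k - \<omega> t $ neg_end N k)))
        = (\<Sum>i\<in>UNIV. \<omega> t $ Inl i * (flow N (\<eta> t) (Inl i) - Pm_opt $ i))
          + - (\<Sum>j\<in>UNIV. load_damping N $ j * (\<omega> t $ Inr j)\<^sup>2)" .
    \<comment> \<open>The flow in the swing equation cancels the line power at the generators;
      damping and the exchange term of \<open>gen_dissipation\<close> are left.\<close>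
    have gens: "(\<Sum>i\<in>UNIV. \<omega> t $ Inl i * (flow N (\<eta> t) (Inl i) - Pm_opt $ i))
          + (\<Sum>i\<in>UNIV. inertia N $ i * \<omega>g' t $ i * \<omega> t $ Inl i)
        = (\<Sum>i\<in>UNIV. - gen_damping N $ i * (\<omega> t $ Inl i)\<^sup>2 + \<omega> t $ Inl i * Pm_err i t)"
      unfolding swing(2)[OF t] Pm_err_def sum.distrib[symmetric]
      by (rule sum.cong) (auto simp: power2_eq_square algebra_simps)
    have "W' t = - (\<Sum>j\<in>UNIV. load_damping N $ j * (\<omega> t $ Inr j)\<^sup>2) +
        (\<Sum>i\<in>UNIV. - gen_damping N $ i * (\<omega> t $ Inl i)\<^sup>2 + \<omega> t $ Inl i * Pm_err i t
          + gen_storage_rate G i (Pm_err i t) (Ps_err i t) (\<theta>_err i t) (Pm' t $ i) (Ps' t $ i) (\<theta>' t $ i))"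
      unfolding W'_def lines sum.distrib[of "\<lambda>i. - gen_damping N $ i * (\<omega> t $ Inl i)\<^sup>2 + \<omega> t $ Inl i * Pm_err i t"]
        gens[symmetric] by simp
    also have "\<dots> \<le> - (\<Sum>j\<in>UNIV. load_damping N $ j * (\<omega> t $ Inr j)\<^sup>2) +
        (\<Sum>i\<in>UNIV. - (marginal_err i t * com_err i t) - c i * ((\<omega> t $ Inl i)\<^sup>2 + (Pm_err i t - \<theta>_err i t)\<^sup>2))"
      by (intro add_left_mono sum_mono c t)
    also have "(\<Sum>i\<in>UNIV. - (marginal_err i t * com_err i t) - c i * ((\<omega> t $ Inl i)\<^sup>2 + (Pm_err i t - \<theta>_err i t)\<^sup>2))
        = - (\<Sum>i\<in>UNIV. marginal_err i t * com_err i t) - (\<Sum>i\<in>UNIV. c i * ((\<omega> t $ Inl i)\<^sup>2 + (Pm_err i t - \<theta>_err i t)\<^sup>2))"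
      by (simp add: sum_subtractf sum_negf)
    also have "(\<Sum>i\<in>UNIV. marginal_err i t * com_err i t) = (\<Sum>(i, j)\<in>com G. (marginal_err i t - marginal_err j t)\<^sup>2) / 2"
      unfolding com_err_def by (rule laplacian_form[OF com_sym])
    finally show "W' t \<le> - ((\<Sum>j\<in>UNIV. load_damping N $ j * (\<omega> t $ Inr j)\<^sup>2) +
        (\<Sum>i\<in>UNIV. c i * ((\<omega> t $ Inl i)\<^sup>2 + (Pm_err i t - \<theta>_err i t)\<^sup>2)) +
        (\<Sum>(i, j)\<in>com G. (marginal_err i t - marginal_err j t)\<^sup>2) / 2)" by simp
  qed
qed

end

section \<open>Confinement of the angle differences\<close>

context closed_loop begin

lemma W_le:
  assumes "0 \<le> t"
  shows "W t \<le> W 0"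
proof (cases "t = 0")
  case False
  then obtain z where z: "0 < z" "W t - W 0 = (t - 0) * W' z"
    using mvt_halfline[OF W_deriv, of 0 t] assms by auto
  obtain c where c: "\<And>i. 0 < c i"
    "\<And>t. 0 \<le> t \<Longrightarrow> W' t \<le> - ((\<Sum>j\<in>UNIV. load_damping N $ j * (\<omega> t $ Inr j)\<^sup>2) +
        (\<Sum>i\<in>UNIV. c i * ((\<omega> t $ Inl i)\<^sup>2 + (Pm_err i t - \<theta>_err i t)\<^sup>2)) +
        (\<Sum>(i, j)\<in>com G. (marginal_err i t - marginal_err j t)\<^sup>2) / 2)"
    using dissipation by blast
  have "0 \<le> (\<Sum>j\<in>UNIV. load_damping N $ j * (\<omega> z $ Inr j)\<^sup>2)"
    "0 \<le> (\<Sum>i\<in>UNIV. c i * ((\<omega> z $ Inl i)\<^sup>2 + (Pm_err i z - \<theta>_err i z)\<^sup>2))"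
    "0 \<le> (\<Sum>(i, j)\<in>com G. (marginal_err i z - marginal_err j z)\<^sup>2)"
    using c(1) network_pos by (auto intro!: sum_nonneg simp: less_imp_le)
  then have "W' z \<le> 0" using c(2)[of z] z by linarith
  then show ?thesis using z assms mult_nonneg_nonpos[of t "W' z"] by simp
qed simp

text \<open>For angle differences in the open interval all summands of the storage are nonnegative,
  so the total dominates each of them.\<close>

lemma W_bounds:
  assumes "\<And>k. \<eta> t $ k \<in> {- pi / 2 <..< pi / 2}"
  shows "line_weight N $ k * line_storage (\<eta>_bar $ k) (\<eta> t $ k) \<le> W t"
    "inertia N $ i / 2 * (\<omega> t $ Inl i)\<^sup>2 \<le> W t"
    "gen_storage G i (Pm_err i t) (Ps_err i t) (\<theta>_err i t) \<le> W t"
    "0 \<le> W t"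
proof -
  define A where "A k = line_weight N $ k * line_storage (\<eta>_bar $ k) (\<eta> t $ k)" for k
  define B where "B i = inertia N $ i / 2 * (\<omega> t $ Inl i)\<^sup>2" for i
  define C where "C i = gen_storage G i (Pm_err i t) (Ps_err i t) (\<theta>_err i t)" for i
  have W: "W t = sum A UNIV + sum B UNIV + sum C UNIV"
    by (simp add: W_def storage_def A_def B_def C_def Pm_err_def Ps_err_def \<theta>_err_def)
  have nonneg: "0 \<le> A k" "0 \<le> B i" "0 \<le> C i" for k i
    using assms angles network_pos
    by (auto simp: A_def B_def C_def less_imp_le gen_storage_nonneg[OF generation]
        intro!: mult_nonneg_nonneg line_storage_nonneg)
  have "A k \<le> sum A UNIV" "B i \<le> sum B UNIV" "C i \<le> sum C UNIV"
    by (auto intro!: member_le_sum nonneg)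
  moreover have "0 \<le> sum A UNIV" "0 \<le> sum B UNIV" "0 \<le> sum C UNIV"
    by (auto intro!: sum_nonneg nonneg)
  ultimately have "A k \<le> W t" "B i \<le> W t" "C i \<le> W t" "0 \<le> W t"
    unfolding W by linarith+
  then show "line_weight N $ k * line_storage (\<eta>_bar $ k) (\<eta> t $ k) \<le> W t"
    "inertia N $ i / 2 * (\<omega> t $ Inl i)\<^sup>2 \<le> W t"
    "gen_storage G i (Pm_err i t) (Ps_err i t) (\<theta>_err i t) \<le> W t"
    "0 \<le> W t" by (simp_all add: A_def B_def C_def)
qed

text \<open>If a line left the radius \<open>r\<close>, the largest angle error would by continuity
  equal \<open>r\<close> at some time. Then all lines are still in the region where
  \<open>W_bounds\<close> applies, while one of them alone stores at least \<open>v\<close>, against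
  \<open>W z \<le> W 0 < v\<close>.\<close>

lemma confinement:
  assumes barrier: "\<And>k z. \<bar>z - \<eta>_bar $ k\<bar> \<le> r \<Longrightarrow> z \<in> {- pi / 2 <..< pi / 2}"
      "\<And>k z. \<bar>z - \<eta>_bar $ k\<bar> = r \<Longrightarrow> v \<le> line_weight N $ k * line_storage (\<eta>_bar $ k) z"
    and initial: "W 0 < v" "\<And>k. \<bar>\<eta> 0 $ k - \<eta>_bar $ k\<bar> < r"
    and "0 \<le> t"
  shows "\<eta> t $ k \<in> {- pi / 2 <..< pi / 2}"
proof (rule barrier(1), rule ccontr)
  define m where "m t = infnorm (\<eta> t - \<eta>_bar)" for t
  have attained: "\<exists>k. \<bar>\<eta> t $ k - \<eta>_bar $ k\<bar> = m t" for t
  proof -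
    have "m t = Max (range (\<lambda>k. \<bar>(\<eta> t - \<eta>_bar) $ k\<bar>))"
      unfolding m_def infnorm_cart by (subst cSup_eq_Max[symmetric]) (auto simp: full_SetCompr_eq)
    then have "m t \<in> range (\<lambda>k. \<bar>(\<eta> t - \<eta>_bar) $ k\<bar>)" by (simp only:) (rule Max_in, auto)
    then show ?thesis by auto
  qed
  have le: "\<bar>\<eta> t $ k - \<eta>_bar $ k\<bar> \<le> m t" for t k
    using component_le_infnorm_cart[of "\<eta> t - \<eta>_bar" k] by (simp add: m_def)
  assume "\<not> \<bar>\<eta> t $ k - \<eta>_bar $ k\<bar> \<le> r"
  then have "r \<le> m t" using le[of t k] by linarith
  moreover have "m 0 \<le> r" using attained[of 0] initial(2) by (metis less_imp_le)
  moreover have "continuous_on {0..t} \<eta>"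
    by (rule continuous_on_subset[of "{0..}"])
      (auto intro: continuous_on_vector_derivative derivs(1))
  then have "continuous_on {0..t} m"
    unfolding m_def continuous_on_def by (auto intro!: tendsto_infnorm tendsto_intros)
  \<comment> \<open>Any time at which the maximum equals \<open>r\<close> will do, because
    \<open>W_le\<close> holds wherever the angles are.\<close>
  ultimately obtain z where z: "0 \<le> z" "m z = r" using IVT'[of m 0 r t] \<open>0 \<le> t\<close> by auto
  obtain k where k: "\<bar>\<eta> z $ k - \<eta>_bar $ k\<bar> = r" using attained[of z] z by auto
  have "\<eta> z $ k \<in> {- pi / 2 <..< pi / 2}" for k
    using barrier(1)[of "\<eta> z $ k" k] le[of z k] z by simp
  then have "v \<le> W z" using barrier(2)[OF k] W_bounds(1)[of z k] by (meson order_trans)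
  then show False using W_le[OF z(1)] initial(1) by linarith
qed

end

section \<open>Boundedness of the solution and its rates\<close>

locale confined_closed_loop = closed_loop +
  assumes confined: "\<And>t k. 0 \<le> t \<Longrightarrow> \<eta> t $ k \<in> {- pi / 2 <..< pi / 2}"
begin

lemma gen_valid:
  "i \<in> Vg1 G \<or> i \<in> Vg2 G" "0 < Tm G $ i" "i \<in> Vg2 G \<Longrightarrow> 0 < Ts G $ i" "0 < Ttheta G $ i"
  "0 < droop G $ i" "0 < q_cost G $ i" "i \<in> Vg2 G \<Longrightarrow> i \<notin> Vg1 G"
  using generation by (auto simp: valid_generation_def)

lemma bounded_gen_frequency: "bounded_halfline (\<lambda>t. \<omega> t $ Inl i)"
proof (rule bounded_halfline_square)
  show "0 < inertia N $ i / 2" using network_pos by simp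
  show "inertia N $ i / 2 * (\<omega> t $ Inl i)\<^sup>2 \<le> W 0" if "0 \<le> t" for t
    by (rule order_trans[OF W_bounds(2)[OF confined[OF that]] W_le[OF that]])
qed

lemma gen_storage_le: "0 \<le> t \<Longrightarrow> gen_storage G i (Pm_err i t) (Ps_err i t) (\<theta>_err i t) \<le> W 0"
  by (rule order_trans[OF W_bounds(3)[OF confined] W_le])

text \<open>Each square in the generator storage is at most \<open>W 0\<close> up to its weight. At
  second-order generators the storage controls \<open>p - s\<close> and \<open>s\<close>, and their
  sum bounds \<open>p\<close>.\<close>

lemma bounded_errors:
  "bounded_halfline (Pm_err i)" "bounded_halfline (\<theta>_err i)"
  "i \<in> Vg2 G \<Longrightarrow> bounded_halfline (Ps_err i)"
proof -
  have "bounded_halfline (Pm_err i) \<and> bounded_halfline (\<theta>_err i) \<and>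
      (i \<in> Vg2 G \<longrightarrow> bounded_halfline (Ps_err i))"
  proof (cases "i \<in> Vg1 G")
    case True
    define K where "K = droop G $ i / 2"
    have pos: "0 < K * Tm G $ i" "0 < K * Ttheta G $ i" using gen_valid(2,4,5)[of i] by (simp_all add: K_def)
    have le: "K * Tm G $ i * (Pm_err i t)\<^sup>2 + K * Ttheta G $ i * (\<theta>_err i t)\<^sup>2 \<le> W 0"
      if "0 \<le> t" for t
      using gen_storage_le[OF that, of i] True by (simp add: gen_storage_def K_def algebra_simps)
    have nonneg: "0 \<le> K * Tm G $ i * (Pm_err i t)\<^sup>2" "0 \<le> K * Ttheta G $ i * (\<theta>_err i t)\<^sup>2" for t
      using pos by (simp_all add: less_imp_le)
    have "K * Tm G $ i * (Pm_err i t)\<^sup>2 \<le> W 0" "K * Ttheta G $ i * (\<theta>_err i t)\<^sup>2 \<le> W 0"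
      if "0 \<le> t" for t using le[OF that] nonneg[of t] by linarith+
    then show ?thesis
      using bounded_halfline_square[OF pos(1), of "Pm_err i" "W 0"]
        bounded_halfline_square[OF pos(2), of "\<theta>_err i" "W 0"] gen_valid(7)[of i] True by blast
  next
    case False
    then have pos: "0 < Ttheta G $ i / 2" "0 < Ts G $ i / 2"
      using gen_valid(1)[of i] gen_valid(3)[of i] gen_valid(4)[of i] by auto
    have le: "Ttheta G $ i / 2 * (\<theta>_err i t)\<^sup>2 + Ts G $ i / 2 * (Ps_err i t)\<^sup>2
        + Ts G $ i / 2 * (Pm_err i t - Ps_err i t)\<^sup>2 \<le> W 0" if "0 \<le> t" for t
      using gen_storage_le[OF that, of i] False by (simp add: gen_storage_def field_simps)
    have nonneg: "0 \<le> Ttheta G $ i / 2 * (\<theta>_err i t)\<^sup>2" "0 \<le> Ts G $ i / 2 * (Ps_err i t)\<^sup>2"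
      "0 \<le> Ts G $ i / 2 * (Pm_err i t - Ps_err i t)\<^sup>2" for t
      using pos by (simp_all add: less_imp_le)
    have "Ttheta G $ i / 2 * (\<theta>_err i t)\<^sup>2 \<le> W 0" "Ts G $ i / 2 * (Ps_err i t)\<^sup>2 \<le> W 0"
      "Ts G $ i / 2 * (Pm_err i t - Ps_err i t)\<^sup>2 \<le> W 0" if "0 \<le> t" for t
      using le[OF that] nonneg[of t] by linarith+
    then have "bounded_halfline (\<theta>_err i)" "bounded_halfline (Ps_err i)"
      "bounded_halfline (\<lambda>t. Pm_err i t - Ps_err i t)"
      using bounded_halfline_square[OF pos(1), of "\<theta>_err i" "W 0"]
        bounded_halfline_square[OF pos(2), of "Ps_err i" "W 0"]
        bounded_halfline_square[OF pos(2), of "\<lambda>t. Pm_err i t - Ps_err i t" "W 0"] by blast+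
    then show ?thesis
      using bounded_halfline_add[of "\<lambda>t. Pm_err i t - Ps_err i t" "Ps_err i"] by simp
  qed
  then show "bounded_halfline (Pm_err i)" "bounded_halfline (\<theta>_err i)"
    "i \<in> Vg2 G \<Longrightarrow> bounded_halfline (Ps_err i)" by auto
qed

lemma bounded_flow: "bounded_halfline (\<lambda>t. flow N (\<eta> t) i)"
  unfolding flow_def by (intro bounded_halfline_intros)

lemma bounded_com_err: "bounded_halfline (com_err i)"
  unfolding com_err_def[abs_def] marginal_err_def by (intro bounded_halfline_intros bounded_errors)

text \<open>The algebraic load equation solved for the frequency. The solution concept demands no
  derivative of load frequencies, but this expression inherits one from \<open>\<eta>\<close>, as
  the Barbalat argument requires.\<close>

definition \<omega>l where
  "\<omega>l j t = (- flow N (\<eta> t) (Inr j) - load_power N $ j) / load_damping N $ j"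

lemma load_frequency: "0 \<le> t \<Longrightarrow> \<omega> t $ Inr j = \<omega>l j t"
  using swing(3)[of t j] network_pos(4)[of j] by (simp add: \<omega>l_def field_simps)

lemma bounded_frequency: "bounded_halfline (\<lambda>t. \<omega> t $ i)"
proof (cases i)
  case (Inr j)
  have "bounded_halfline (\<omega>l j)"
    unfolding \<omega>l_def[abs_def] by (intro bounded_halfline_intros bounded_flow)
  then show ?thesis unfolding Inr by (rule bounded_halfline_cong) (rule load_frequency)
qed (simp add: bounded_gen_frequency)

lemma bounded_rates:
  "bounded_halfline (\<lambda>t. \<omega>g' t $ i)" "bounded_halfline (\<lambda>t. Pm' t $ i)"
  "bounded_halfline (\<lambda>t. \<theta>' t $ i)"
proof -
  have Pm: "Pm t $ i = Pm_err i t + Pm_opt $ i" for t by (simp add: Pm_err_def)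
  show "bounded_halfline (\<lambda>t. \<omega>g' t $ i)"
  proof (rule bounded_halfline_cong)
    show "bounded_halfline (\<lambda>t. (- (gen_damping N $ i * \<omega> t $ Inl i) - flow N (\<eta> t) (Inl i)
        + (Pm_err i t + Pm_opt $ i)) / inertia N $ i)"
      by (intro bounded_halfline_intros bounded_frequency bounded_flow bounded_errors)
    show "\<omega>g' t $ i = (- (gen_damping N $ i * \<omega> t $ Inl i) - flow N (\<eta> t) (Inl i)
        + (Pm_err i t + Pm_opt $ i)) / inertia N $ i" if "0 \<le> t" for t
      using swing(2)[OF that, of i] network_pos(2)[of i] by (simp add: Pm field_simps)
  qed
  have cancel: "a = b / c" if "c * a = b" "0 < c" for a b c :: real
    using that by (simp add: field_simps)
  have "bounded_halfline (\<lambda>t. Pm' t $ i) \<and> bounded_halfline (\<lambda>t. \<theta>' t $ i)"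
  proof (cases "i \<in> Vg1 G")
    case True
    have "bounded_halfline (\<lambda>t. (- Pm_err i t - inverse (droop G $ i) * \<omega> t $ Inl i + \<theta>_err i t)
        / Tm G $ i)"
      "bounded_halfline (\<lambda>t. (- \<theta>_err i t + Pm_err i t
        - inverse (droop G $ i) * q_cost G $ i * com_err i t) / Ttheta G $ i)"
      by (intro bounded_halfline_intros bounded_frequency bounded_com_err bounded_errors)+
    then show ?thesis
      using cancel[OF governor1(1)[OF _ True] gen_valid(2)]
        cancel[OF governor1(2)[OF _ True] gen_valid(4)]
      by (auto intro: bounded_halfline_cong)
  next
    case False
    then have i: "i \<in> Vg2 G" using gen_valid by blast
    have "bounded_halfline (\<lambda>t. (- Pm_err i t + Ps_err i t) / Tm G $ i)"
      "bounded_halfline (\<lambda>t. (- \<theta>_err i t + Ps_err i t - (1 - inverse (droop G $ i)) * \<omega> t $ Inl i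
        - q_cost G $ i * com_err i t) / Ttheta G $ i)"
      by (intro bounded_halfline_intros bounded_frequency bounded_com_err bounded_errors i)+
    then show ?thesis
      using cancel[OF governor2(2)[OF _ i] gen_valid(2)] cancel[OF governor2(3)[OF _ i] gen_valid(4)]
      by (auto intro: bounded_halfline_cong)
  qed
  then show "bounded_halfline (\<lambda>t. Pm' t $ i)" "bounded_halfline (\<lambda>t. \<theta>' t $ i)" by auto
qed

section \<open>Convergence to the optimum\<close>

lemma dissipated_tendsto_0:
  assumes "0 < c" "\<And>t. 0 \<le> t \<Longrightarrow> W' t \<le> - (c * (f t)\<^sup>2)"
    and "\<And>t. 0 \<le> t \<Longrightarrow> (f has_real_derivative f' t) (at t within {0..})" "bounded_halfline f'"
  shows "(f \<longlongrightarrow> 0) at_top"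
proof -
  obtain L where "L-lipschitz_on {0..} f" using bounded_derivative_lipschitz assms(3,4) by blast
  then show ?thesis
    using barbalat_dissipation[of W W' c f L] W_deriv assms(1,2) W_bounds(4) confined by blast
qed

lemma load_frequency_deriv:
  assumes "0 \<le> t"
  shows "(\<omega>l j has_real_derivative (- (\<Sum>k\<in>UNIV. incidence N $ Inr j $ k * (line_weight N $ k *
      (cos (\<eta> t $ k) * (\<omega> t $ pos_end N k - \<omega> t $ neg_end N k)))) - 0) / load_damping N $ j)
    (at t within {0..})"
  unfolding \<omega>l_def[abs_def] flow_def
  by (intro DERIV_cdivide DERIV_diff DERIV_minus DERIV_sum DERIV_cmult DERIV_const
      DERIV_chain2[OF DERIV_sin] line_deriv assms)

lemma dissipated_errors_tendsto_0:
  "((\<lambda>t. \<omega> t $ n) \<longlongrightarrow> 0) at_top" "((\<lambda>t. Pm_err i t - \<theta>_err i t) \<longlongrightarrow> 0) at_top"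
  "(i, j) \<in> com G \<Longrightarrow> ((\<lambda>t. marginal_err i t - marginal_err j t) \<longlongrightarrow> 0) at_top"
proof -
  obtain c where c: "\<And>i. 0 < c i"
    "\<And>t. 0 \<le> t \<Longrightarrow> W' t \<le> - ((\<Sum>j\<in>UNIV. load_damping N $ j * (\<omega> t $ Inr j)\<^sup>2) +
        (\<Sum>i\<in>UNIV. c i * ((\<omega> t $ Inl i)\<^sup>2 + (Pm_err i t - \<theta>_err i t)\<^sup>2)) +
        (\<Sum>(i, j)\<in>com G. (marginal_err i t - marginal_err j t)\<^sup>2) / 2)"
    using dissipation by blast
  \<comment> \<open>Since all dissipation terms are nonnegative, each alone bounds the decrease of
    \<open>W\<close>, so that Barbalat's lemma applies to one quantity at a time.\<close>
  have terms: "W' t \<le> - (load_damping N $ l * (\<omega> t $ Inr l)\<^sup>2)"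
    "W' t \<le> - (c i * (\<omega> t $ Inl i)\<^sup>2)" "W' t \<le> - (c i * (Pm_err i t - \<theta>_err i t)\<^sup>2)"
    "(i, j) \<in> com G \<Longrightarrow> W' t \<le> - (1 / 2 * (marginal_err i t - marginal_err j t)\<^sup>2)"
    if "0 \<le> t" for t l i j
  proof -
    define A where "A j = load_damping N $ j * (\<omega> t $ Inr j)\<^sup>2" for j
    define B where "B i = c i * ((\<omega> t $ Inl i)\<^sup>2 + (Pm_err i t - \<theta>_err i t)\<^sup>2)" for i
    define C where "C = (\<lambda>(i, j). (marginal_err i t - marginal_err j t)\<^sup>2)"
    have nonneg: "0 \<le> A j" "0 \<le> B i" "0 \<le> C e" for j i e
      using c(1) network_pos by (auto simp: A_def B_def C_def less_imp_le split: prod.split)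
    have W': "W' t \<le> - (sum A UNIV + sum B UNIV + sum C (com G) / 2)"
      using c(2)[OF that] by (simp add: A_def B_def C_def)
    have sums: "0 \<le> sum A UNIV" "0 \<le> sum B UNIV" "0 \<le> sum C (com G)"
      by (auto intro!: sum_nonneg nonneg)
    have "A l \<le> sum A UNIV" "B i \<le> sum B UNIV" by (auto intro!: member_le_sum nonneg)
    then have "W' t \<le> - A l" "W' t \<le> - B i" using W' sums by linarith+
    moreover have "c i * (\<omega> t $ Inl i)\<^sup>2 \<le> B i" "c i * (Pm_err i t - \<theta>_err i t)\<^sup>2 \<le> B i"
      using c(1)[of i] by (auto simp: B_def)
    ultimately show "W' t \<le> - (load_damping N $ l * (\<omega> t $ Inr l)\<^sup>2)"
      "W' t \<le> - (c i * (\<omega> t $ Inl i)\<^sup>2)" "W' t \<le> - (c i * (Pm_err i t - \<theta>_err i t)\<^sup>2)"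
      by (auto simp: A_def)
    show "W' t \<le> - (1 / 2 * (marginal_err i t - marginal_err j t)\<^sup>2)" if "(i, j) \<in> com G"
    proof -
      have "C (i, j) \<le> sum C (com G)" using that by (intro member_le_sum nonneg) auto
      then show ?thesis using W' sums by (simp add: C_def)
    qed
  qed
  show "((\<lambda>t. \<omega> t $ n) \<longlongrightarrow> 0) at_top"
  proof (cases n)
    case (Inl i)
    show ?thesis unfolding Inl
      by (rule dissipated_tendsto_0[OF c(1) terms(2) swing(1) bounded_rates(1)])
  next
    case (Inr l)
    have "bounded_halfline (\<lambda>t. (- (\<Sum>k\<in>UNIV. incidence N $ Inr l $ k * (line_weight N $ k *
      (cos (\<eta> t $ k) * (\<omega> t $ pos_end N k - \<omega> t $ neg_end N k)))) - 0) / load_damping N $ l)"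
      by (intro bounded_halfline_intros bounded_frequency)
    from dissipated_tendsto_0[OF network_pos(4)[of l] _ load_frequency_deriv this]
    have "(\<omega>l l \<longlongrightarrow> 0) at_top" using terms(1)[of _ l] load_frequency by simp
    moreover have "\<forall>\<^sub>F t in at_top. \<omega>l l t = \<omega> t $ n"
      using eventually_ge_at_top[of "0::real"] by eventually_elim (simp add: Inr load_frequency)
    ultimately show ?thesis by (rule Lim_transform_eventually)
  qed
  show "((\<lambda>t. Pm_err i t - \<theta>_err i t) \<longlongrightarrow> 0) at_top"
    by (rule dissipated_tendsto_0[OF c(1) terms(3) DERIV_diff[OF power_derivs(1,3)]])
      (auto intro!: bounded_halfline_intros bounded_rates)
  have deriv: "((\<lambda>t. marginal_err i t - marginal_err j t) has_real_derivative
      q_cost G $ i * \<theta>' t $ i - q_cost G $ j * \<theta>' t $ j) (at t within {0..})" if "0 \<le> t" for t i j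
    unfolding marginal_err_def by (intro DERIV_diff DERIV_cmult power_derivs that)
  show "((\<lambda>t. marginal_err i t - marginal_err j t) \<longlongrightarrow> 0) at_top" if "(i, j) \<in> com G"
    by (rule dissipated_tendsto_0[OF _ terms(4)[OF _ that] deriv])
      (auto intro!: bounded_halfline_intros bounded_rates)
qed

text \<open>The total momentum tends to 0 and its derivative differs from the power imbalance by a null
  function, so the imbalance vanishes as well.\<close>

lemma total_power_error_tendsto_0: "((\<lambda>t. \<Sum>i\<in>UNIV. Pm_err i t) \<longlongrightarrow> 0) at_top"
proof -
  define b where "b t = - (\<Sum>i\<in>UNIV. gen_damping N $ i * \<omega> t $ Inl i)
    - (\<Sum>j\<in>UNIV. load_damping N $ j * \<omega> t $ Inr j)" for t
  \<comment> \<open>In the sum of all swing and load equations the line flows cancel and the optimal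
    generation balances the load; the total power error and the damping \<open>b\<close>
    remain.\<close>
  have sum_deriv: "(\<Sum>i\<in>UNIV. inertia N $ i * \<omega>g' t $ i) = (\<Sum>i\<in>UNIV. Pm_err i t) + b t"
    if "0 \<le> t" for t
    using sum_flow_eq_0[OF network, of "\<eta> t"] solves_OPT_balance[OF opt]
    unfolding swing(2)[OF that] b_def swing(3)[OF that]
    by (simp add: Pm_err_def sum.distrib sum_subtractf sum_negf)
  have "((\<lambda>t. \<Sum>i\<in>UNIV. inertia N $ i * \<omega> t $ Inl i) has_real_derivative
      (\<Sum>i\<in>UNIV. Pm_err i t) + b t) (at t within {0..})" if "0 \<le> t" for t
    unfolding sum_deriv[OF that, symmetric] by (intro DERIV_sum DERIV_cmult swing that)
  moreover have "bounded_halfline (\<lambda>t. \<Sum>i\<in>UNIV. Pm' t $ i)"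
    by (intro bounded_halfline_intros bounded_rates)
  from bounded_derivative_lipschitz[OF DERIV_sum[OF power_derivs(1)] this]
  obtain L where "L-lipschitz_on {0..} (\<lambda>t. \<Sum>i\<in>UNIV. Pm_err i t)" by blast
  moreover have lim: "((\<lambda>t. \<Sum>i\<in>UNIV. d $ i * \<omega> t $ f i) \<longlongrightarrow> 0) at_top" for d :: "real ^ 'n::finite" and f
    by (intro tendsto_null_sum tendsto_mult_right_zero dissipated_errors_tendsto_0)
  then have "((\<lambda>t. \<Sum>i\<in>UNIV. inertia N $ i * \<omega> t $ Inl i) \<longlongrightarrow> 0) at_top" by blast
  moreover have "(b \<longlongrightarrow> 0) at_top"
    unfolding b_def[abs_def] using tendsto_diff[OF tendsto_minus[OF lim] lim] by simp
  ultimately show ?thesis by (rule barbalat_derivative)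
qed

text \<open>Differences along communication edges vanish, and they telescope along a path from
  \<open>i\<close> to \<open>j\<close>.\<close>

lemma marginal_err_consensus: "((\<lambda>t. marginal_err i t - marginal_err j t) \<longlongrightarrow> 0) at_top"
proof -
  have "(i, j) \<in> (com G)\<^sup>*" using com_connected by (simp add: connected_relation_def)
  then show ?thesis
  proof induction
    case (step j k)
    from tendsto_add[OF step.IH dissipated_errors_tendsto_0(3)[OF step.hyps(2)]]
    show ?case by simp
  qed simp
qed

text \<open>By consensus all marginal errors share one asymptotic value, so the errors of
  \<open>\<theta>\<close> add up to that value times \<open>Q\<close>. The same sum follows the
  total power error, which vanishes; as \<open>Q\<close> is positive, the common value tends to
  0.\<close>

lemma Pm_err_tendsto_0: "(Pm_err i \<longlongrightarrow> 0) at_top"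
proof -
  define Q where "Q = (\<Sum>j\<in>UNIV. 1 / q_cost G $ j)"
  have "0 < Q" unfolding Q_def using gen_valid by (intro sum_pos) auto
  have \<theta>: "\<theta>_err j t = marginal_err j t / q_cost G $ j" for j t
    using gen_valid(6)[of j] by (simp add: marginal_err_def)
  have "marginal_err i t * Q = (\<Sum>j\<in>UNIV. Pm_err j t) - (\<Sum>j\<in>UNIV. Pm_err j t - \<theta>_err j t)
      - (\<Sum>j\<in>UNIV. (marginal_err j t - marginal_err i t) / q_cost G $ j)" for t
    by (simp add: Q_def \<theta> sum_distrib_left sum_subtractf diff_divide_distrib)
  then have "marginal_err i = (\<lambda>t. ((\<Sum>j\<in>UNIV. Pm_err j t) - (\<Sum>j\<in>UNIV. Pm_err j t - \<theta>_err j t)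
      - (\<Sum>j\<in>UNIV. (marginal_err j t - marginal_err i t) / q_cost G $ j)) / Q)"
    using \<open>0 < Q\<close> by (simp add: fun_eq_iff field_simps)
  moreover have "((\<lambda>t. ((\<Sum>j\<in>UNIV. Pm_err j t) - (\<Sum>j\<in>UNIV. Pm_err j t - \<theta>_err j t)
      - (\<Sum>j\<in>UNIV. (marginal_err j t - marginal_err i t) / q_cost G $ j)) / Q) \<longlongrightarrow>
      (0 - 0 - 0) / Q) at_top"
    using \<open>0 < Q\<close>
    by (intro tendsto_divide tendsto_diff tendsto_null_sum tendsto_divide_zero tendsto_const
        total_power_error_tendsto_0 dissipated_errors_tendsto_0(2) marginal_err_consensus) simp
  ultimately have "(marginal_err i \<longlongrightarrow> 0) at_top" by simp
  then have "((\<lambda>t. (Pm_err i t - \<theta>_err i t) + marginal_err i t / q_cost G $ i) \<longlongrightarrow>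
      0 + 0 / q_cost G $ i) at_top"
    using gen_valid(6)[of i]
    by (intro tendsto_intros dissipated_errors_tendsto_0) auto
  then show ?thesis by (simp add: \<theta>[symmetric])
qed

lemma convergence:
  "((\<lambda>t. infdist (\<eta> t, \<omega> t, Pm t, Ps t, \<theta> t)
      {(\<eta>, \<omega>, Pm, Ps, \<theta>). \<omega> = 0 \<and> Pm = Pm_opt}) \<longlongrightarrow> 0) at_top"
proof (rule tendsto_sandwich[OF _ _ tendsto_const])
  show "\<forall>\<^sub>F t in at_top. 0 \<le> infdist (\<eta> t, \<omega> t, Pm t, Ps t, \<theta> t)
      {(\<eta>, \<omega>, Pm, Ps, \<theta>). \<omega> = 0 \<and> Pm = Pm_opt}"
    by (simp add: infdist_nonneg)
  \<comment> \<open>Keeping \<open>\<eta>\<close>, \<open>Ps\<close> and \<open>\<theta>\<close>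
    gives a point of the target set, so only the errors of \<open>\<omega>\<close> and
    \<open>Pm\<close> remain to be estimated.\<close>
  have "infdist (\<eta> t, \<omega> t, Pm t, Ps t, \<theta> t) {(\<eta>, \<omega>, Pm, Ps, \<theta>). \<omega> = 0 \<and> Pm = Pm_opt}
      \<le> dist (\<eta> t, \<omega> t, Pm t, Ps t, \<theta> t) (\<eta> t, 0, Pm_opt, Ps t, \<theta> t)" for t
    by (rule infdist_le) auto
  then show "\<forall>\<^sub>F t in at_top. infdist (\<eta> t, \<omega> t, Pm t, Ps t, \<theta> t)
      {(\<eta>, \<omega>, Pm, Ps, \<theta>). \<omega> = 0 \<and> Pm = Pm_opt}
      \<le> dist (\<eta> t, \<omega> t, Pm t, Ps t, \<theta> t) (\<eta> t, 0, Pm_opt, Ps t, \<theta> t)"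
    by simp
  have "(\<omega> \<longlongrightarrow> 0) at_top"
    by (rule vec_tendstoI) (simp add: dissipated_errors_tendsto_0)
  moreover have "((\<lambda>t. Pm t $ i) \<longlongrightarrow> Pm_opt $ i) at_top" for i
    using tendsto_add[OF Pm_err_tendsto_0[of i] tendsto_const[of "Pm_opt $ i"]]
    by (simp add: Pm_err_def)
  then have "(Pm \<longlongrightarrow> Pm_opt) at_top" by (rule vec_tendstoI)
  ultimately have "((\<lambda>t. sqrt ((norm (\<omega> t))\<^sup>2 + (dist (Pm t) Pm_opt)\<^sup>2)) \<longlongrightarrow>
      sqrt ((norm (0 :: real ^ ('a + 'b)))\<^sup>2 + (dist Pm_opt Pm_opt)\<^sup>2)) at_top"
    by (intro tendsto_intros)
  then show "((\<lambda>t. dist (\<eta> t, \<omega> t, Pm t, Ps t, \<theta> t) (\<eta> t, 0, Pm_opt, Ps t, \<theta> t)) \<longlongrightarrow> 0) at_top"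
    by (simp add: dist_Pair_Pair)
qed

end

section \<open>Vanishing of the steady frequency and local convergence\<close>

theorem theorem1:
  fixes N :: "('g::finite, 'l::finite, 'e::finite) power_network"
    and G :: "'g generation"
    and \<eta>_bar :: "real ^ 'e" and \<omega>_bar :: "real ^ ('g + 'l)" and Pm_opt :: "real ^ 'g"
  assumes "valid_network N"
    and "valid_generation G"
    and "solves_OPT G (load_power N) Pm_opt"
    and "\<eta>_bar \<in> range ((*v) (transpose (incidence N)))"
    and "transpose (incidence N) *v \<omega>_bar = 0"
    and "steady_state N \<eta>_bar \<omega>_bar Pm_opt"
    and "\<And>k. \<eta>_bar $ k \<in> {- pi / 2 <..< pi / 2}"
    and "\<And>i. i \<in> Vg2 G \<Longrightarrow> droop_condition N G i"
    and "sym (com G)"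
    and "connected_relation (com G)"
  shows "\<omega>_bar = 0 \<and>
    0 = - ((gen_rows (incidence N) ** diag_matrix (line_weight N)) *v sin_vec \<eta>_bar) + Pm_opt \<and>
    0 = - ((load_rows (incidence N) ** diag_matrix (line_weight N)) *v sin_vec \<eta>_bar)
        - load_power N \<and>
    (\<exists>\<epsilon>>0. \<forall>\<eta> \<omega> Pm Ps \<theta>.
      closed_loop_solution N G \<eta> \<omega> Pm Ps \<theta> \<longrightarrow>
      dist (\<eta> 0, \<omega> 0, Pm 0, Ps 0, \<theta> 0) (\<eta>_bar, 0, Pm_opt, Ps_opt G Pm_opt, Pm_opt) < \<epsilon> \<longrightarrow>
      ((\<lambda>t. infdist (\<eta> t, \<omega> t, Pm t, Ps t, \<theta> t)
              {(\<eta>, \<omega>, Pm, Ps, \<theta>). \<omega> = 0 \<and> Pm = Pm_opt}) \<longlongrightarrow> 0) at_top)"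
proof -
  note N = assms(1)
  \<comment> \<open>The bus \<open>undefined\<close> is an arbitrary one: on the connected network a
    vector in the kernel has the same entry at every bus.\<close>
  define w where "w = \<omega>_bar $ undefined"
  have w: "\<omega>_bar $ i = w" for i
    unfolding w_def by (rule incidence_transpose_kernel[OF N assms(5)])
  have balance: "0 = - (gen_damping N $ i * w) - flow N \<eta>_bar (Inl i) + Pm_opt $ i"
    "0 = - (load_damping N $ j * w) - flow N \<eta>_bar (Inr j) - load_power N $ j" for i j
    using assms(6) unfolding steady_state_def network_eqs_components[OF N] by (simp_all add: w)
  \<comment> \<open>Adding the balances of all buses cancels the flows and, by feasibility of the
    optimum, the powers. Total damping times \<open>w\<close> is left, and total damping is
    positive.\<close>
  have "0 = (\<Sum>i\<in>UNIV. - (gen_damping N $ i * w) - flow N \<eta>_bar (Inl i) + Pm_opt $ i)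
      + (\<Sum>j\<in>UNIV. - (load_damping N $ j * w) - flow N \<eta>_bar (Inr j) - load_power N $ j)"
    unfolding balance[symmetric] by simp
  also have "\<dots> = - (((\<Sum>i\<in>UNIV. gen_damping N $ i) + (\<Sum>j\<in>UNIV. load_damping N $ j)) * w)"
    using sum_flow_eq_0[OF N, of \<eta>_bar] solves_OPT_balance[OF assms(3)]
    by (simp add: sum.distrib sum_subtractf sum_negf sum_distrib_right distrib_right)
  finally have "((\<Sum>i\<in>UNIV. gen_damping N $ i) + (\<Sum>j\<in>UNIV. load_damping N $ j)) * w = 0" by simp
  moreover have "0 < (\<Sum>i\<in>UNIV. gen_damping N $ i)" "0 < (\<Sum>j\<in>UNIV. load_damping N $ j)"
    using N by (auto simp: valid_network_def intro!: sum_pos)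
  ultimately have "w = 0" by simp
  have flows: "flow N \<eta>_bar (Inl i) = Pm_opt $ i" "flow N \<eta>_bar (Inr j) = - load_power N $ j" for i j
    using balance(1)[of i] balance(2)[of j] \<open>w = 0\<close> by simp_all
  interpret optimal_equilibrium N G \<eta>_bar Pm_opt
    by unfold_locales (use assms flows in auto)
  obtain r v where r: "0 < r" "0 < v"
    and barrier: "\<And>k z. \<bar>z - \<eta>_bar $ k\<bar> \<le> r \<Longrightarrow> z \<in> {- pi / 2 <..< pi / 2}"
      "\<And>k z. \<bar>z - \<eta>_bar $ k\<bar> = r \<Longrightarrow> v \<le> line_weight N $ k * line_storage (\<eta>_bar $ k) z"
    using storage_barrier by blast
  obtain \<epsilon> where \<epsilon>: "0 < \<epsilon>"
    "\<And>\<eta> \<omega> Pm Ps \<theta>. dist (\<eta>, \<omega>, Pm, Ps, \<theta>) (\<eta>_bar, 0, Pm_opt, Ps_opt G Pm_opt, Pm_opt) < \<epsilon> \<Longrightarrow>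
      storage \<eta> \<omega> Pm Ps \<theta> < v \<and> (\<forall>k. \<bar>\<eta> $ k - \<eta>_bar $ k\<bar> < r)"
    using storage_near_equilibrium[OF r(2,1)] by blast
  have "((\<lambda>t. infdist (\<eta> t, \<omega> t, Pm t, Ps t, \<theta> t)
              {(\<eta>, \<omega>, Pm, Ps, \<theta>). \<omega> = 0 \<and> Pm = Pm_opt}) \<longlongrightarrow> 0) at_top"
    if solution: "closed_loop_solution N G \<eta> \<omega> Pm Ps \<theta>"
      and near: "dist (\<eta> 0, \<omega> 0, Pm 0, Ps 0, \<theta> 0)
        (\<eta>_bar, 0, Pm_opt, Ps_opt G Pm_opt, Pm_opt) < \<epsilon>" for \<eta> \<omega> Pm Ps \<theta>
  proof -
    from solution obtain \<eta>' \<omega>g' Pm' Ps' \<theta>' where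
      "closed_loop N G \<eta>_bar Pm_opt \<eta> \<eta>' \<omega> \<omega>g' Pm Ps \<theta> Pm' Ps' \<theta>'"
      unfolding closed_loop_solution_def closed_loop_def closed_loop_axioms_def
      using optimal_equilibrium_axioms by blast
    then interpret closed_loop N G \<eta>_bar Pm_opt \<eta> \<eta>' \<omega> \<omega>g' Pm Ps \<theta> Pm' Ps' \<theta>' .
    interpret confined_closed_loop N G \<eta>_bar Pm_opt \<eta> \<eta>' \<omega> \<omega>g' Pm Ps \<theta> Pm' Ps' \<theta>'
      by unfold_locales (use confinement[OF barrier] \<epsilon>(2)[OF near] in \<open>auto simp: W_def\<close>)
    show ?thesis by (rule convergence)
  qed
  moreover have "\<omega>_bar = 0" using w \<open>w = 0\<close> by (simp add: vec_eq_iff)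
  moreover have "0 = - ((gen_rows (incidence N) ** diag_matrix (line_weight N)) *v sin_vec \<eta>_bar) + Pm_opt"
    "0 = - ((load_rows (incidence N) ** diag_matrix (line_weight N)) *v sin_vec \<eta>_bar)
        - load_power N"
    by (simp_all add: vec_eq_iff flows)
  ultimately show ?thesis using \<epsilon>(1) by blast
qed

end
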